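(* Let $f\in\mathcal{C}^1(\mathbb{R}^2)\cap\mathcal{A}$ be supported in $\mathbb{B}^\circ$ and let $M,N\in\mathbb{N}$. Then there exist constants $c_f>0$ (depending only on $f$) and $D[M,N]>0$ (depending only on $M,N$) such that $$\left\|S_{M,N}^{K}(f)-S_{M,N}(f)\right\|_\infty\le\frac{2c_fD[M,N]}{K}\qquad\text{for every }K\in\mathbb{N}\text{ with } K\ge K[M,N].$$
   Context: $\mathbb{N}=\{1,2,\dots\}$. $\mathbb{B}$ and $\mathbb{B}^\circ$ are the closed and open unit disks of $\mathbb{R}^2$; $\mathrm{supp}(f)=\{\mathbf{x}: f(\mathbf{x})\neq 0\}$ and $f$ is supported in $X$ if $\mathrm{supp}(f)\subseteq X$. $\|f\|_\infty=\sup_{\mathbf{x}}|f(\mathbf{x})|$. $\mathcal{C}^q(\mathbb{R}^2)$ is the set of functions $\mathbb{R}^2\to\mathbb{C}$ all of whose partial derivatives of order $\le q$ exist and are continuous. $\mathcal{V}$ is the set of square integrable $f:\mathbb{R}^2\to\mathbb{C}$ supported in $\mathbb{B}$. For $\mathbf{k}\in\mathbb{Z}^2$, $\widehat f(\mathbf{k})=\int_{\mathbb{R}^2}f(\mathbf{x})e^{-\mathrm{i}\pi\langle\mathbf{k},\mathbf{x}\rangle}\,d\mathbf{x}$. $\mathcal{A}=\{f\in\mathcal{V}:\sum_{\mathbf{k}\in\mathbb{Z}^2}|\widehat f(\mathbf{k})|<\infty\}$. Bessel notation: $J_m$ is the Bessel function of the first kind of order $m\in\mathbb{Z}$, $0<z_{m,1}<z_{m,2}<\cdots$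 are its positive zeros, $K_{m,n}:=\lceil z_{m,n}/\pi\rceil$, and $K[M,N]:=\max\{K_{m,n}:0\le m\le M,\ 1\le n\le N\}$. In polar coordinates, $\Psi_{m,n}(r,\theta)=\frac{e^{\mathrm{i}m\theta}J_m(z_{m,n}r)}{\sqrt{\pi}\,|J_{m+1}(z_{m,n})|}$ if $r\le 1$, and $0$ if $r>1$. The Fourier-Bessel coefficient is $C_{m,n}(f)=\int_0^{2\pi}\int_0^1 f(r,\theta)\overline{\Psi_{m,n}(r,\theta)}\,r\,dr\,d\theta$, and the partial sums are $S_{M,N}(f)=\sum_{m=-M}^M\sum_{n=1}^N C_{m,n}(f)\Psi_{m,n}$. Finite Fourier transform: for $L\in\mathbb{N}$, $\widehat f(\mathbf{k};L)=\delta^2\sum_{i=1}^L\sum_{j=1}^L f(x_i,x_j)e^{-\pi\mathrm{i}(k_1x_i+k_2x_j)}$ with $\delta=2/L$, $x_i=-1+(i-1)\delta$. Coefficients: for $\mathbf{k}=(k_1,k_2)\in\mathbb{Z}^2$, $\mathbf{c}(\mathbf{k};m,n)=\varepsilon_m\sqrt{\pi}(-1)^n\mathrm{i}^m z_{m,n}\frac{J_m(\pi\|\mathbf{k}\|_2)e^{-\mathrm{i}m\Phi(\mathbf{k})}}{2(\pi^2\|\mathbf{k}\|_2^2-z_{m,n}^2)}$, where $\varepsilon_m=1$ if $m\ge0$, $\varepsilon_m=(-1)^m$ if $m<0$, and $\Phi(\mathbf{k})=\mathrm{atan2}(k_2,k_1)$ is the polar angle of $\mathbf{k}$ (with value $0$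 at $\mathbf{k}=0$). If $\pi\|\mathbf{k}\|_2=z_{m,n}$, the quotient $J_m(\pi\|\mathbf{k}\|_2)/(\pi^2\|\mathbf{k}\|_2^2-z_{m,n}^2)$ is understood as its limiting value $J_m'(z_{m,n})/(2z_{m,n})$. Finite and inverse finite Fourier-Bessel transforms of order $K\in\mathbb{N}$: $C_{m,n}^K(f)=\sum_{\mathbf{k}\in\mathbb{Z}^2,\ \|\mathbf{k}\|_\infty\le K}\mathbf{c}(\mathbf{k};m,n)\,\widehat f(\mathbf{k};2K+1)$ and $S_{M,N}^K(f)=\sum_{m=-M}^M\sum_{n=1}^N C_{m,n}^K(f)\Psi_{m,n}$. *)

theory Defs
  imports "HOL-Analysis.Analysis"
begin

type_synonym plane_fun = "real \<times> real \<Rightarrow> complex"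

text \<open>The norm on \<^typ>\<open>real \<times> real\<close> is the Euclidean one, so \<^term>\<open>ball 0 1\<close> and
  \<^term>\<open>cball 0 1\<close> are the open and closed unit disks; \<^term>\<open>support_on UNIV f\<close> is
  the set of points where \<open>f\<close> does not vanish (no closure is taken).\<close>

text \<open>Values in \<^typ>\<open>ereal\<close>, so that the supremum of an unbounded function is \<open>\<infinity>\<close>.\<close>

definition sup_norm :: "plane_fun \<Rightarrow> ereal" where
  "sup_norm f = (SUP x. ereal (cmod (f x)))"

text \<open>\<open>C_space q\<close>: all partial derivatives of order at most \<open>q\<close> exist and are
  continuous, where \<open>f1\<close> and \<open>f2\<close> below are the first-order partial derivatives.\<close>

primrec C_space :: "nat \<Rightarrow> plane_fun set" where
  "C_space 0 = {f. continuous_on UNIV f}"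
| "C_space (Suc q) = {f. continuous_on UNIV f \<and>
     (\<exists>f1\<in>C_space q. \<exists>f2\<in>C_space q. \<forall>x y.
        ((\<lambda>t. f (t, y)) has_vector_derivative f1 (x, y)) (at x) \<and>
        ((\<lambda>t. f (x, t)) has_vector_derivative f2 (x, y)) (at y))}"

definition V_space :: "plane_fun set" where
  "V_space = {f. f \<in> borel_measurable lebesgue \<and>
     integrable lebesgue (\<lambda>x. (cmod (f x))\<^sup>2) \<and> support_on UNIV f \<subseteq> cball 0 1}"

definition fourier_coeff :: "plane_fun \<Rightarrow> int \<times> int \<Rightarrow> complex" where
  "fourier_coeff f k = (LINT x|lebesgue.
     f x * exp (- \<i> * of_real (pi * (of_int (fst k) * fst x + of_int (snd k) * snd x))))"

definition A_space :: "plane_fun set" where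
  "A_space = {f \<in> V_space. (\<lambda>k. cmod (fourier_coeff f k)) summable_on UNIV}"

text \<open>The power series
  \<open>J\<^sub>m(x) = \<Sum>j. (-1)^j / (j! \<Gamma>(m + j + 1)) * (x/2)^(2j + m)\<close>
  for arbitrary integer order, where the entire function \<^const>\<open>rGamma\<close> is the reciprocal of
  \<open>\<Gamma>\<close>. For \<open>m < 0\<close> the terms with \<open>j < -m\<close> vanish, in particular all those with a negative
  exponent, so the formula is also correct at \<open>x = 0\<close>.\<close>

definition bessel_J :: "int \<Rightarrow> real \<Rightarrow> real" where
  "bessel_J m x = (\<Sum>j::nat.
     (-1) ^ j / fact j * rGamma (of_int (m + int j + 1)) * (x / 2) powi (2 * int j + m))"

text \<open>\<open>bessel_zero m n\<close> is the \<open>n\<close>-th positive zero of \<open>J\<^sub>m\<close> for \<open>n \<ge> 1\<close>: the smallest zero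
  beyond the previous one. The value 0 at \<open>n = 0\<close> only starts the recursion.\<close>

primrec bessel_zero :: "int \<Rightarrow> nat \<Rightarrow> real" where
  "bessel_zero m 0 = 0"
| "bessel_zero m (Suc n) = Inf {t. bessel_zero m n < t \<and> bessel_J m t = 0}"

definition K_index :: "int \<Rightarrow> nat \<Rightarrow> int" where
  "K_index m n = \<lceil>bessel_zero m n / pi\<rceil>"

definition K_max :: "nat \<Rightarrow> nat \<Rightarrow> int" where
  "K_max M N = Max {K_index (int m) n | m n. m \<le> M \<and> 1 \<le> n \<and> n \<le> N}"

definition Psi_polar :: "int \<Rightarrow> nat \<Rightarrow> real \<Rightarrow> real \<Rightarrow> complex" where
  "Psi_polar m n r \<theta> =
     (if r \<le> 1
      then exp (\<i> * of_int m * of_real \<theta>) * of_real (bessel_J m (bessel_zero m n * r)) /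
           of_real (sqrt pi * \<bar>bessel_J (m + 1) (bessel_zero m n)\<bar>)
      else 0)"

text \<open>The polar angle \<open>atan2(y, x)\<close> in \<open>(-\<pi>, \<pi>]\<close>, with value 0 at the origin.\<close>

definition polar_angle :: "real \<times> real \<Rightarrow> real" where
  "polar_angle x = Arg (Complex (fst x) (snd x))"

definition Psi :: "int \<Rightarrow> nat \<Rightarrow> plane_fun" where
  "Psi m n x = Psi_polar m n (norm x) (polar_angle x)"

definition FB_coeff :: "int \<Rightarrow> nat \<Rightarrow> plane_fun \<Rightarrow> complex" where
  "FB_coeff m n f = integral {0..2 * pi} (\<lambda>\<theta>. integral {0..1} (\<lambda>r.
     f (r * cos \<theta>, r * sin \<theta>) * cnj (Psi_polar m n r \<theta>) * of_real r))"

definition FB_sum :: "nat \<Rightarrow> nat \<Rightarrow> plane_fun \<Rightarrow> plane_fun" where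
  "FB_sum M N f x = (\<Sum>m\<in>{- int M..int M}. \<Sum>n\<in>{1..N}. FB_coeff m n f * Psi m n x)"

definition grid_point :: "nat \<Rightarrow> nat \<Rightarrow> real" where
  "grid_point L i = - 1 + (real i - 1) * (2 / real L)"

definition finite_fourier :: "nat \<Rightarrow> plane_fun \<Rightarrow> int \<times> int \<Rightarrow> complex" where
  "finite_fourier L f k = of_real ((2 / real L)\<^sup>2) *
     (\<Sum>i\<in>{1..L}. \<Sum>j\<in>{1..L}. f (grid_point L i, grid_point L j) *
        exp (- of_real pi * \<i> *
          of_real (of_int (fst k) * grid_point L i + of_int (snd k) * grid_point L j)))"

definition real_vec :: "int \<times> int \<Rightarrow> real \<times> real" where
  "real_vec k = (of_int (fst k), of_int (snd k))"

definition bessel_quotient :: "int \<Rightarrow> nat \<Rightarrow> real \<Rightarrow> real" where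
  "bessel_quotient m n t =
     (if t = bessel_zero m n
      then deriv (bessel_J m) (bessel_zero m n) / (2 * bessel_zero m n)
      else bessel_J m t / (t\<^sup>2 - (bessel_zero m n)\<^sup>2))"

definition eps :: "int \<Rightarrow> real" where
  "eps m = (if m \<ge> 0 then 1 else (-1) powi m)"

definition c_coeff :: "int \<times> int \<Rightarrow> int \<Rightarrow> nat \<Rightarrow> complex" where
  "c_coeff k m n =
     of_real (eps m * sqrt pi * (-1) ^ n) * \<i> powi m *
     of_real (bessel_zero m n * bessel_quotient m n (pi * norm (real_vec k)) / 2) *
     exp (- \<i> * of_int m * of_real (polar_angle (real_vec k)))"

definition finite_FB_coeff :: "nat \<Rightarrow> int \<Rightarrow> nat \<Rightarrow> plane_fun \<Rightarrow> complex" where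
  "finite_FB_coeff K m n f =
     (\<Sum>k\<in>{k. max \<bar>fst k\<bar> \<bar>snd k\<bar> \<le> int K}. c_coeff k m n * finite_fourier (2 * K + 1) f k)"

definition finite_FB_sum :: "nat \<Rightarrow> nat \<Rightarrow> nat \<Rightarrow> plane_fun \<Rightarrow> plane_fun" where
  "finite_FB_sum K M N f x =
     (\<Sum>m\<in>{- int M..int M}. \<Sum>n\<in>{1..N}. finite_FB_coeff K m n f * Psi m n x)"

end

theory Submission
  imports Defs
begin

text \<open>The coefficient \<open>c(k;m,n)\<close> is a quarter of the Fourier-Bessel coefficient of the mode \<open>exp(i\<pi>\<langle>k,x\<rangle>)\<close>:
  this is the Jacobi-Anger integral over the angle followed by Lommel's integral over the radius, the sign
  \<open>(-1)\<^sup>n\<close> being that of \<open>-J\<^sub>m\<^sub>+\<^sub>1\<close> at the \<open>n\<close>-th zero of \<open>J\<^sub>m\<close>. Since the Fourier series of \<open>f\<close> converges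
  absolutely and uniformly to \<open>f\<close> on the square, \<open>C\<^sub>m\<^sub>,\<^sub>n(f)\<close> is the sum of \<open>c(k;m,n)\<close> times the \<open>k\<close>-th Fourier
  coefficient. As \<open>J\<^sub>m(t) = O(t\<^sup>-\<^sup>1\<^sup>/\<^sup>2)\<close>, \<open>c(k;m,n)\<close> decays like \<open>|k|\<^sup>-\<^sup>5\<^sup>/\<^sup>2\<close>, hence is summable over the lattice and
  \<open>O(1/K)\<close> outside the box of size \<open>K\<close>; the latter bounds the truncation error. The quadrature error in the
  Fourier coefficients is \<open>O(1/K)\<close> uniformly over the box, because \<open>f\<close> is Lipschitz and vanishes on the
  boundary of the square. The two errors add up to the claim.\<close>

section \<open>Quadrature of oscillating integrals\<close>

text \<open>At the edge of the box the integrand f(x) exp(-i pi <k,x>) has derivatives of size K on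
  a mesh of width about 1/K, so comparing it with its samples cell by cell yields only O(1). Hence
  the exponential is integrated exactly and only f is frozen on each cell; what remains is an
  exponential sum with slowly varying coefficients. Summation by parts controls it while successive
  samples turn by at most pi, that is for 2|k_i| <= L, which holds on the box with L = 2K + 1. On a
  two-dimensional lattice |k|^(-2) is not summable; the additional |k|^(-1/2) from the decay of J_m
  makes the coefficients absolutely summable. The two errors pair sums and suprema in opposite ways:
  inside the box a uniform quadrature bound meets the sum of |c(k;m,n)|, outside it a uniform bound
  on |c(k;m,n)| meets the sum of the Fourier coefficients of f. Each error is therefore a factor
  depending on f times a factor depending on m and n, which separates c_f from D[M,N].\<close>

lemma x_cos_le_sin:
  fixes x :: real
  assumes "0 \<le> x" "x \<le> pi"
  shows "x * cos x \<le> sin x"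
proof -
  have "x * cos x - sin x \<le> 0 * cos 0 - sin 0"
  proof (rule DERIV_nonpos_imp_nonincreasing[OF assms(1)])
    fix t :: real
    assume t: "0 \<le> t" "t \<le> x"
    have "((\<lambda>t. t * cos t - sin t) has_real_derivative - (t * sin t)) (at t)"
      by (auto intro!: derivative_eq_intros)
    moreover have "- (t * sin t) \<le> 0"
      using t assms by (auto intro!: mult_nonneg_nonneg sin_ge_zero)
    ultimately show "\<exists>y. ((\<lambda>t. t * cos t - sin t) has_real_derivative y) (at t) \<and> y \<le> 0"
      by blast
  qed
  thus ?thesis by simp
qed

text \<open>By the double angle formula and \<open>x_cos_le_sin\<close>, sin x = 2 sin(x/2) cos(x/2)
  >= x cos(x/2)^2, and 2 cos(x/2)^2 = 1 + cos x >= 1 on this range.\<close>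

lemma half_le_sin:
  fixes x :: real
  assumes "0 \<le> x" "x \<le> pi / 2"
  shows "x / 2 \<le> sin x"
proof -
  have c: "0 \<le> cos x" "0 \<le> cos (x/2)"
    using assms by (auto intro!: cos_ge_zero)
  have "x / 2 * 1 \<le> x / 2 * (2 * (cos (x / 2))\<^sup>2)"
    using c assms cos_double_cos[of "x/2"] by (intro mult_left_mono) auto
  also have "\<dots> = 2 * (x / 2 * cos (x / 2)) * cos (x / 2)"
    by (simp add: power2_eq_square)
  also have "\<dots> \<le> 2 * sin (x / 2) * cos (x / 2)"
    using x_cos_le_sin[of "x/2"] assms c by (intro mult_right_mono mult_left_mono) auto
  also have "\<dots> = sin x"
    using sin_double[of "x/2"] by simp
  finally show ?thesis by simp
qed

lemma norm_cis_minus_1: "cmod (cis t - 1) = 2 * \<bar>sin (t / 2)\<bar>"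
  using dist_exp_i_1[of t] by (simp add: cis_conv_exp)

lemma norm_cis_minus_1_le: "cmod (cis t - 1) \<le> \<bar>t\<bar>"
  using abs_sin_x_le_abs_x[of "t/2"] by (simp add: norm_cis_minus_1)

text \<open>Up to half a turn the chord stays comparable to the arc. In the quadrature
  \<open>t\<close> is the phase step \<open>c * d\<close> between neighbouring samples, which the
  frequency restriction keeps below pi.\<close>

lemma norm_cis_minus_1_ge:
  assumes "\<bar>t\<bar> \<le> pi"
  shows "\<bar>t\<bar> / 2 \<le> cmod (cis t - 1)"
proof -
  have "\<bar>t\<bar> / 2 / 2 \<le> sin (\<bar>t\<bar> / 2)"
    using assms by (intro half_le_sin) auto
  also have "\<dots> \<le> \<bar>sin (t / 2)\<bar>"
    by (cases "t \<ge> 0") (auto simp: abs_if)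
  finally show ?thesis by (simp add: norm_cis_minus_1)
qed

text \<open>Abel summation: multiplying by \<open>w - 1\<close> moves the differences onto
  \<open>h\<close>, and the boundary terms vanish with \<open>h 0\<close> and \<open>h L\<close>.
  The factor \<open>w - 1\<close> stays on the left so that \<open>w = 1\<close> needs no separate
  case.\<close>

lemma norm_geometric_sum_le:
  fixes h :: "nat \<Rightarrow> complex"
  assumes "h 0 = 0" "h L = 0" "\<And>i. i < L \<Longrightarrow> cmod (h (Suc i) - h i) \<le> b" "cmod w = 1"
  shows "cmod (\<Sum>i<L. h i * w ^ i) * cmod (w - 1) \<le> real L * b"
proof -
  have *: "(\<Sum>i<n. h i * w ^ i) * (w - 1) = h n * w ^ n - h 0 - (\<Sum>i<n. (h (Suc i) - h i) * w ^ Suc i)" for n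
    by (induction n) (auto simp: algebra_simps)
  have "cmod ((\<Sum>i<L. h i * w ^ i) * (w - 1)) = cmod (\<Sum>i<L. (h (Suc i) - h i) * w ^ Suc i)"
    using assms by (simp add: *)
  also have "\<dots> \<le> (\<Sum>i<L. b)"
    using assms by (intro sum_norm_le) (auto simp: norm_mult norm_power)
  finally show ?thesis by (simp add: norm_mult)
qed

lemma integral_cells:
  fixes g :: "real \<Rightarrow> complex"
  assumes "continuous_on {a..a + real n * d} g" "d \<ge> 0"
  shows "integral {a..a + real n * d} g = (\<Sum>i<n. integral {a + real i * d..a + real (Suc i) * d} g)"
  using assms(1)
proof (induction n)
  case (Suc n)
  have le: "a + real n * d \<le> a + real (Suc n) * d" "a \<le> a + real n * d"
    using assms(2) by (auto simp: mult_right_mono)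
  have "integral {a..a + real (Suc n) * d} g =
      integral {a..a + real n * d} g + integral {a + real n * d..a + real (Suc n) * d} g"
    using Suc.prems le
    by (intro Henstock_Kurzweil_Integration.integral_combine[symmetric] integrable_continuous_real) auto
  moreover have "continuous_on {a..a + real n * d} g"
    using Suc.prems le by (auto elim!: continuous_on_subset)
  ultimately show ?case using Suc.IH by simp
qed auto

lemma integral_cis_shift:
  "integral {a..a + d} (\<lambda>x. cis (c * x)) = cis (c * a) * integral {0..d} (\<lambda>x. cis (c * x))"
proof -
  have "integral {a..a + d} (\<lambda>x. cis (c * x)) = integral {0..d} ((\<lambda>x. cis (c * x)) \<circ> ((+) a))"
    by (simp add: integral_shift_Icc_real add.commute)
  also have "\<dots> = integral {0..d} (\<lambda>x. cis (c * a) * cis (c * x))"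
    by (simp add: o_def cis_mult algebra_simps)
  finally show ?thesis by simp
qed

text \<open>The error of the quadrature on one cell is \<open>h(x\<^sub>i)\<close> times a constant \<open>r = O(c d\<^sup>2)\<close> times a
  root of unity, up to the oscillation of \<open>h\<close> on the cell; summation by parts gains back the factor \<open>c d\<close>.\<close>

lemma quadrature_error:
  fixes h :: "real \<Rightarrow> complex" and c :: real
  assumes lip: "\<And>x y. x \<in> {-1..1} \<Longrightarrow> y \<in> {-1..1} \<Longrightarrow> cmod (h x - h y) \<le> B * \<bar>x - y\<bar>"
    and h: "h (-1) = 0" "h 1 = 0" and L: "L \<ge> 1" and c: "2 * \<bar>c\<bar> \<le> pi * real L" and B: "B \<ge> 0"
  shows "cmod (of_real (2 / real L) * (\<Sum>i\<in>{1..L}. h (grid_point L i) * cis (c * grid_point L i)) -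
           integral {-1..1} (\<lambda>x. h x * cis (c * x))) \<le> 12 * B / real L"
proof -
  define d where "d = 2 / real L"
  define x where "x = (\<lambda>i::nat. -1 + real i * d)"
  have d: "d > 0" "real L * d = 2" using L by (auto simp: d_def)
  have x01: "x 0 = -1" "x L = 1" using d by (auto simp: x_def)
  have xS: "x (Suc i) = x i + d" for i by (simp add: x_def algebra_simps)
  have xin: "x i \<in> {-1..1}" if "i \<le> L" for i
  proof -
    have "real i * d \<le> real L * d" using that d by (intro mult_right_mono) auto
    thus ?thesis using d by (auto simp: x_def)
  qed
  have hcont: "continuous_on {-1..1} h"
    by (rule lipschitz_on_continuous_on[of B], rule lipschitz_onI)
       (use lip B in \<open>auto simp: dist_norm\<close>)
  have econt: "continuous_on S (\<lambda>x. cis (c * x))" for S by (intro continuous_intros)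
  \<comment> \<open>\<open>r\<close> is the error of the left endpoint rule for the pure exponential
    on the cell starting at 0; by translation its error on the cell starting at \<open>x i\<close>
    is \<open>cis (c * x i) * r\<close>.\<close>
  define r where "r = of_real d - integral {0..d} (\<lambda>t. cis (c * t))"
  have r: "cmod r \<le> \<bar>c\<bar> * d * d"
  proof -
    have "r = integral {0..d} (\<lambda>t. 1 - cis (c * t))"
      unfolding r_def using d
      by (subst Henstock_Kurzweil_Integration.integral_diff) (auto intro!: integrable_continuous_real econt simp: scaleR_conv_of_real)
    also have "cmod \<dots> \<le> (\<bar>c\<bar> * d) * (d - 0)"
    proof (rule integral_bound)
      fix t assume t: "t \<in> {0..d}"
      have "cmod (1 - cis (c * t)) \<le> \<bar>c * t\<bar>"
        using norm_cis_minus_1_le[of "c * t"] by (simp add: norm_minus_commute)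
      also have "\<dots> \<le> \<bar>c\<bar> * d" using t by (simp add: abs_mult mult_left_mono)
      finally show "cmod (1 - cis (c * t)) \<le> \<bar>c\<bar> * d" .
    qed (use d in \<open>auto intro!: continuous_intros\<close>)
    finally show ?thesis by simp
  qed
  define S where "S = (\<Sum>i<L. h (x i) * cis (c * x i))"
  have S: "cmod S * (\<bar>c * d\<bar> / 2) \<le> 2 * B"
  proof -
    have "S = cis (- c) * (\<Sum>i<L. h (x i) * cis (c * d) ^ i)"
      unfolding S_def sum_distrib_left
      by (intro sum.cong refl) (simp add: Complex.DeMoivre cis_mult x_def algebra_simps)
    hence S_eq: "cmod S = cmod (\<Sum>i<L. h (x i) * cis (c * d) ^ i)"
      by (simp add: norm_mult)
    have "cmod S * (\<bar>c * d\<bar> / 2) \<le> cmod S * cmod (cis (c * d) - 1)"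
      using c d L by (intro mult_left_mono norm_cis_minus_1_ge) (auto simp: d_def abs_mult field_simps)
    also have "\<dots> \<le> real L * (B * d)"
      unfolding S_eq
    proof (rule norm_geometric_sum_le)
      fix i assume "i < L"
      thus "cmod (h (x (Suc i)) - h (x i)) \<le> B * d"
        using lip[OF xin[of "Suc i"] xin[of i]] d by (simp add: xS)
    qed (use x01 h in auto)
    also have "\<dots> = 2 * B" using d by (simp add: algebra_simps)
    finally show ?thesis .
  qed
  have I: "integral {-1..1} (\<lambda>x. h x * cis (c * x)) =
      (\<Sum>i<L. integral {x i..x (Suc i)} (\<lambda>x. h x * cis (c * x)))"
    using integral_cells[of "-1" L d "\<lambda>x. h x * cis (c * x)"] d
    by (simp add: x_def hcont econt continuous_on_mult)
  define E where "E = (\<lambda>i. integral {x i..x (Suc i)} (\<lambda>t. (h t - h (x i)) * cis (c * t)))"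
  have E: "cmod (E i) \<le> B * d * d" if i: "i < L" for i
  proof -
    have sub: "{x i..x (Suc i)} \<subseteq> {-1..1}"
      using xin[of i] xin[of "Suc i"] i by auto
    have "cmod (E i) \<le> (B * d) * (x (Suc i) - x i)"
      unfolding E_def
    proof (rule integral_bound)
      show "x i \<le> x (Suc i)" using d by (simp add: xS)
      show "continuous_on {x i..x (Suc i)} (\<lambda>t. (h t - h (x i)) * cis (c * t))"
        by (intro continuous_intros continuous_on_subset[OF hcont sub])
      fix t assume t: "t \<in> {x i..x (Suc i)}"
      have "cmod (h t - h (x i)) \<le> B * \<bar>t - x i\<bar>"
        using t i xin[of i] subsetD[OF sub t] by (intro lip) auto
      also have "\<dots> \<le> B * d" using t B by (intro mult_left_mono) (auto simp: xS)
      finally show "cmod ((h t - h (x i)) * cis (c * t)) \<le> B * d"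
        by (simp add: norm_mult)
    qed
    thus ?thesis by (simp add: xS)
  qed
  have cell: "of_real d * (h (x i) * cis (c * x i)) - integral {x i..x (Suc i)} (\<lambda>x. h x * cis (c * x))
      = r * (h (x i) * cis (c * x i)) - E i" if i: "i < L" for i
  proof -
    have sub: "{x i..x (Suc i)} \<subseteq> {-1..1}"
      using xin[of i] xin[of "Suc i"] i by auto
    have "E i = integral {x i..x (Suc i)} (\<lambda>t. h t * cis (c * t)) - h (x i) * integral {x i..x (Suc i)} (\<lambda>t. cis (c * t))"
      unfolding E_def left_diff_distrib
      by (subst Henstock_Kurzweil_Integration.integral_diff)
         (auto intro!: integrable_continuous_real continuous_intros continuous_on_subset[OF hcont sub])
    also have "integral {x i..x (Suc i)} (\<lambda>t. cis (c * t)) = cis (c * x i) * integral {0..d} (\<lambda>t. cis (c * t))"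
      by (simp only: xS integral_cis_shift)
    finally show ?thesis by (simp add: r_def algebra_simps)
  qed
  have "(\<Sum>i\<in>{1..L}. h (grid_point L i) * cis (c * grid_point L i)) = S"
    unfolding S_def
    by (rule sum.reindex_bij_witness[of _ Suc "\<lambda>i. i - 1"]) (auto simp: grid_point_def x_def d_def)
  hence "of_real (2 / real L) * (\<Sum>i\<in>{1..L}. h (grid_point L i) * cis (c * grid_point L i)) -
      integral {-1..1} (\<lambda>x. h x * cis (c * x)) = of_real d * S - integral {-1..1} (\<lambda>x. h x * cis (c * x))"
    by (simp add: d_def)
  also have "\<dots> = (\<Sum>i<L. r * (h (x i) * cis (c * x i)) - E i)"
    unfolding I S_def sum_distrib_left sum_subtractf[symmetric] using cell by (intro sum.cong) auto
  also have "\<dots> = r * S - (\<Sum>i<L. E i)"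
    by (simp add: S_def sum_subtractf sum_distrib_left)
  also have "cmod \<dots> \<le> cmod r * cmod S + cmod (\<Sum>i<L. E i)"
    by (metis norm_mult norm_triangle_ineq4)
  also have "cmod (\<Sum>i<L. E i) \<le> (\<Sum>i<L. B * d * d)"
    using E by (intro sum_norm_le) auto
  also have "(\<Sum>i<L. B * d * d) = 2 * B * d"
    using d by (simp add: algebra_simps)
  \<comment> \<open>The factor \<open>\<bar>c\<bar> * d\<close> in the bound for \<open>r\<close> is
    exactly the one that multiplies \<open>cmod S\<close> in the summation by parts. This gives 4 B
    d; with 2 B d from the \<open>E i\<close> the total is 6 B d = 12 B / L.\<close>
  also have "cmod r * cmod S \<le> (\<bar>c\<bar> * d * d) * cmod S"
    by (intro mult_right_mono r) auto
  also have "\<dots> = 2 * d * (cmod S * (\<bar>c * d\<bar> / 2))"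
    using d by (simp add: abs_mult)
  also have "\<dots> \<le> 2 * d * (2 * B)"
    using d by (intro mult_left_mono S) auto
  finally show ?thesis by (simp add: d_def)
qed

section \<open>Fourier inversion on the square\<close>

lemma has_integral_cis:
  fixes k :: int
  shows "((\<lambda>x. cis (pi * of_int k * x)) has_integral (if k = 0 then 2 else 0)) {-1..1}"
proof (cases "k = 0")
  case True
  thus ?thesis
    using has_integral_const_real[of "1::complex" "-1" 1] by (simp add: scaleR_conv_of_real)
next
  case False
  have [simp]: "- (\<i> * (z * \<i>)) = z" for z
    by (simp add: mult.commute[of z] flip: mult.assoc)
  have "((\<lambda>x. cis (pi * of_int k * x)) has_integral
      cis (pi * of_int k * 1) / (\<i> * of_real (pi * of_int k)) -
      cis (pi * of_int k * (-1)) / (\<i> * of_real (pi * of_int k))) {-1..1}"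
    using False
    by (intro fundamental_theorem_of_calculus)
       (auto simp: cis_conv_exp intro!: derivative_eq_intros has_vector_derivative_real_field)
  moreover have "cis (pi * of_int k * 1) = cis (pi * of_int k * (-1))"
    by (simp add: complex_eq_iff)
  ultimately show ?thesis using False by simp
qed

text \<open>The interval has length 2, so the modes have squared norm 2 and the orthogonal
  projection of \<open>q\<close> onto them is \<open>T / 2\<close>. Expanding the integral of |q -
  T/2|^2, which is nonnegative, gives Q - N/2.\<close>

lemma bessel_inequality:
  fixes q :: "real \<Rightarrow> complex"
  assumes q: "continuous_on {-1..1} q" and A: "finite A"
  defines "qh \<equiv> \<lambda>k. integral {-1..1} (\<lambda>x. q x * cis (- (pi * of_int k * x)))"
  shows "(\<Sum>k\<in>A. (cmod (qh k))\<^sup>2) \<le> 2 * integral {-1..1} (\<lambda>x. (cmod (q x))\<^sup>2)"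
proof -
  define T where "T = (\<lambda>x. \<Sum>k\<in>A. qh k * cis (pi * of_int k * x))"
  have T: "continuous_on {-1..1} T"
    unfolding T_def by (intro continuous_intros)
  define N where "N = (\<Sum>k\<in>A. (cmod (qh k))\<^sup>2)"
  define Q where "Q = integral {-1..1} (\<lambda>x. (cmod (q x))\<^sup>2)"
  have Q: "((\<lambda>x. complex_of_real ((cmod (q x))\<^sup>2)) has_integral of_real Q) {-1..1}"
    unfolding Q_def
    by (intro has_integral_of_real integrable_integral integrable_continuous_real continuous_intros q)
  have qT: "((\<lambda>x. q x * cnj (T x)) has_integral of_real N) {-1..1}"
  proof -
    have "((\<lambda>x. \<Sum>k\<in>A. cnj (qh k) * (q x * cis (- (pi * of_int k * x)))) has_integral (\<Sum>k\<in>A. cnj (qh k) * qh k)) {-1..1}"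
      unfolding qh_def
      by (intro has_integral_sum A has_integral_mult_right integrable_integral
            integrable_continuous_real continuous_intros q)
    thus ?thesis
      by (simp add: T_def N_def sum_distrib_left cis_cnj mult_ac complex_norm_square[unfolded of_real_power])
  qed
  have "((\<lambda>x. T x * cnj (T x)) has_integral of_real (2 * N)) {-1..1}"
  proof -
    have "((\<lambda>x. \<Sum>j\<in>A. \<Sum>k\<in>A. (qh j * cnj (qh k)) * cis (pi * of_int (j - k) * x)) has_integral
        (\<Sum>j\<in>A. \<Sum>k\<in>A. (qh j * cnj (qh k)) * (if j - k = 0 then 2 else 0))) {-1..1}"
      by (intro has_integral_sum A has_integral_mult_right has_integral_cis)
    moreover have "(\<Sum>j\<in>A. \<Sum>k\<in>A. (qh j * cnj (qh k)) * (if j - k = 0 then 2 else 0)) = of_real (2 * N)"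
      using A by (simp add: if_distrib[of "\<lambda>x. _ * x"] sum.delta N_def complex_norm_square[unfolded of_real_power] sum_distrib_left mult_ac cong: if_cong)
    moreover have "T x * cnj (T x) = (\<Sum>j\<in>A. \<Sum>k\<in>A. (qh j * cnj (qh k)) * cis (pi * of_int (j - k) * x))" for x
    proof -
      have "cis (pi * of_int (j - k) * x) = cis (pi * of_int j * x) * cis (- (pi * of_int k * x))" for j k
        by (simp add: cis_mult algebra_simps)
      thus ?thesis by (simp add: T_def sum_product cis_cnj mult_ac)
    qed
    ultimately show ?thesis by simp
  qed
  note TT = this
  have Tq: "((\<lambda>x. T x * cnj (q x)) has_integral of_real N) {-1..1}"
    using has_integral_linear[OF qT bounded_linear_cnj] by (simp add: o_def mult_ac)
  have "((\<lambda>x. of_real ((cmod (q x))\<^sup>2) - q x * cnj (T x) / 2 - T x * cnj (q x) / 2 + T x * cnj (T x) / 4)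
      has_integral of_real Q - of_real N / 2 - of_real N / 2 + of_real (2 * N) / 4) {-1..1}"
    by (intro has_integral_add has_integral_diff has_integral_divide Q qT TT Tq)
  moreover have "of_real ((cmod (q x))\<^sup>2) - q x * cnj (T x) / 2 - T x * cnj (q x) / 2 + T x * cnj (T x) / 4
      = of_real ((cmod (q x - T x / 2))\<^sup>2)" for x
    unfolding complex_norm_square by (simp add: algebra_simps)
  ultimately have I: "((\<lambda>x. complex_of_real ((cmod (q x - T x / 2))\<^sup>2)) has_integral of_real (Q - N / 2)) {-1..1}"
    by simp
  hence "((\<lambda>x. (cmod (q x - T x / 2))\<^sup>2) has_integral (Q - N / 2)) {-1..1}"
    using has_integral_linear[OF I bounded_linear_Re] by (simp only: o_def Re_complex_of_real)
  hence "0 \<le> Q - N / 2"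
    by (rule has_integral_nonneg) auto
  thus ?thesis by (simp add: N_def Q_def)
qed

text \<open>A weak substitute for the Riemann-Lebesgue lemma: \<open>n\<close> coefficients of
  modulus \<open>c\<close> contribute n c^2 to Bessel's inequality, whose right side does not depend
  on \<open>n\<close>.\<close>

lemma const_fourier_coeffs_eq_0:
  fixes q :: "real \<Rightarrow> complex"
  assumes q: "continuous_on {-1..1} q" and A: "infinite A"
    and k: "\<And>k. k \<in> A \<Longrightarrow> cmod (integral {-1..1} (\<lambda>x. q x * cis (- (pi * of_int k * x)))) = c"
  shows "c = 0"
proof (rule ccontr)
  assume "c \<noteq> 0"
  define Q where "Q = 2 * integral {-1..1} (\<lambda>x. (cmod (q x))\<^sup>2)"
  obtain n :: nat where n: "Q / c\<^sup>2 < real n" using reals_Archimedean2 by blast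
  obtain F where F: "F \<subseteq> A" "finite F" "card F = n"
    using infinite_arbitrarily_large[OF A] by metis
  have "real n * c\<^sup>2 = (\<Sum>k\<in>F. (cmod (integral {-1..1} (\<lambda>x. q x * cis (- (pi * of_int k * x)))))\<^sup>2)"
    using F k by (subst sum.cong[OF refl, of _ _ "\<lambda>_. c\<^sup>2"]) auto
  also have "\<dots> \<le> Q"
    unfolding Q_def using F by (intro bessel_inequality q) auto
  finally show False using n \<open>c \<noteq> 0\<close> by (simp add: field_simps)
qed


lemma has_vector_derivative_tendsto:
  assumes "(f has_vector_derivative D) (at a within S)"
  shows "((\<lambda>x. (f x - f a) /\<^sub>R (x - a)) \<longlongrightarrow> D) (at a within S)"
proof -
  have "((\<lambda>y. norm ((f y - f a - (y - a) *\<^sub>R D) /\<^sub>R norm (y - a))) \<longlongrightarrow> 0) (at a within S)"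
    using assms unfolding has_vector_derivative_def has_derivative_at_within by (intro tendsto_norm_zero) auto
  moreover have "eventually (\<lambda>y. norm ((f y - f a - (y - a) *\<^sub>R D) /\<^sub>R norm (y - a)) = norm ((f y - f a) /\<^sub>R (y - a) - D)) (at a within S)"
  proof (unfold eventually_at_filter, intro always_eventually allI impI)
    fix y assume "y \<noteq> a"
    hence "(f y - f a) /\<^sub>R (y - a) - D = (f y - f a - (y - a) *\<^sub>R D) /\<^sub>R (y - a)"
      by (simp add: scaleR_diff_right)
    thus "norm ((f y - f a - (y - a) *\<^sub>R D) /\<^sub>R norm (y - a)) = norm ((f y - f a) /\<^sub>R (y - a) - D)"
      by simp
  qed
  ultimately have "((\<lambda>y. norm ((f y - f a) /\<^sub>R (y - a) - D)) \<longlongrightarrow> 0) (at a within S)"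
    by (rule Lim_transform_eventually)
  hence "((\<lambda>y. (f y - f a) /\<^sub>R (y - a) - D) \<longlongrightarrow> 0) (at a within S)"
    by (rule tendsto_norm_zero_cancel)
  thus ?thesis by (rule LIM_zero_cancel)
qed

text \<open>Chernoff's argument: if all coefficients of \<open>h\<close> vanish, its antiderivative \<open>H\<close> has only a
  zeroth coefficient; dividing \<open>H(x) - H(a)\<close> by \<open>cis (\<pi> (x - a)) - 1\<close> leaves a continuous function whose
  coefficients have constant modulus on each half line, so they vanish by Bessel's inequality.\<close>

lemma fourier_unique_1d:
  fixes h :: "real \<Rightarrow> complex"
  assumes h: "continuous_on {-1..1} h"
    and coeff: "\<And>k::int. integral {-1..1} (\<lambda>x. h x * cis (- (pi * of_int k * x))) = 0"
    and x: "x \<in> {-1..1}"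
  shows "h x = 0"
proof -
  define H where "H = (\<lambda>x. integral {-1..x} h)"
  have H': "(H has_vector_derivative h x) (at x within {-1..1})" if "x \<in> {-1..1}" for x
    unfolding H_def using that by (intro integral_has_vector_derivative h)
  have Hcont: "continuous_on {-1..1} H"
    unfolding continuous_on_eq_continuous_within using H' has_vector_derivative_continuous by blast
  have H1: "H (-1) = 0" "H 1 = 0"
    using coeff[of 0] by (auto simp: H_def)
  have Hk: "integral {-1..1} (\<lambda>x. H x * cis (- (pi * of_int k * x))) = 0" if k: "k \<noteq> 0" for k :: int
  proof -
    define w where "w = - \<i> * of_real (pi * of_int k)"
    have w: "w \<noteq> 0" using k by (simp add: w_def)
    have e: "cis (- (pi * of_int k * x)) = exp (w * of_real x)" for x
      by (simp add: cis_conv_exp w_def mult_ac)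
    have e': "((\<lambda>x. cis (- (pi * of_int k * x))) has_vector_derivative w * cis (- (pi * of_int k * x))) (at x within A)" for x A
      unfolding e by (rule has_vector_derivative_real_field) (auto intro!: derivative_eq_intros)
    have "((\<lambda>x. H x * (w * cis (- (pi * of_int k * x))) + h x * cis (- (pi * of_int k * x))) has_integral
        (H 1 * cis (- (pi * of_int k * 1)) - H (-1) * cis (- (pi * of_int k * (-1))))) {-1..1}"
      by (intro fundamental_theorem_of_calculus has_vector_derivative_mult H' e') auto
    moreover have "((\<lambda>x. h x * cis (- (pi * of_int k * x))) has_integral 0) {-1..1}"
      using coeff[of k] h
      by (auto simp: has_integral_integrable_integral intro!: integrable_continuous_real continuous_intros)
    ultimately have "((\<lambda>x. H x * (w * cis (- (pi * of_int k * x))) + h x * cis (- (pi * of_int k * x)) - h x * cis (- (pi * of_int k * x)))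
        has_integral (H 1 * cis (- (pi * of_int k * 1)) - H (-1) * cis (- (pi * of_int k * (-1))) - 0)) {-1..1}"
      by (rule has_integral_diff)
    hence "((\<lambda>x. w * (H x * cis (- (pi * of_int k * x)))) has_integral 0) {-1..1}"
      by (simp add: H1 mult_ac)
    hence "integral {-1..1} (\<lambda>x. w * (H x * cis (- (pi * of_int k * x)))) = 0"
      by (rule integral_unique)
    thus ?thesis using w by simp
  qed
  define M where "M = integral {-1..1} H / 2"
  have Ha: "H a = M" if a: "a \<in> {-1<..<1}" for a
  proof -
    define E where "E = (\<lambda>x. cis (pi * (x - a)) - 1)"
    \<comment> \<open>Numerator and denominator both vanish at \<open>a\<close>; the value there is
      the quotient of their derivatives, which makes \<open>q\<close> continuous.\<close>
    define q where "q = (\<lambda>x. if x = a then h a / (\<i> * pi) else (H x - H a) / E x)"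
    have E': "(E has_vector_derivative (\<i> * pi)) (at a)"
    proof -
      have "((\<lambda>x. exp (\<i> * pi * (of_real x - of_real a)) - 1) has_vector_derivative (\<i> * pi)) (at a)"
        by (rule has_vector_derivative_real_field) (auto intro!: derivative_eq_intros)
      thus ?thesis by (simp add: E_def cis_conv_exp mult_ac)
    qed
    \<comment> \<open>\<open>E\<close> has period 2, and since \<open>a\<close> is interior no other
      point of the closed interval lies at distance 2 or more from it.\<close>
    have Enz: "E x \<noteq> 0" if "x \<in> {-1..1}" "x \<noteq> a" for x
    proof
      assume "E x = 0"
      hence "cos (pi * (x - a)) = 1" by (simp add: E_def complex_eq_iff)
      then obtain n :: int where "pi * (x - a) = of_int n * 2 * pi"
        using cos_one_2pi_int by blast
      hence n: "x - a = 2 * of_int n" by simp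
      hence "\<bar>real_of_int n\<bar> < 1" using that a by auto
      hence "n = 0" by linarith
      thus False using n that by simp
    qed
    have "continuous (at x within {-1..1}) q" if x: "x \<in> {-1..1}" for x
    proof (cases "x = a")
      case True
      have "((\<lambda>x. ((H x - H a) /\<^sub>R (x - a)) / (E x /\<^sub>R (x - a))) \<longlongrightarrow> h a / (\<i> * pi)) (at a within {-1..1})"
      proof (rule tendsto_divide)
        show "((\<lambda>x. (H x - H a) /\<^sub>R (x - a)) \<longlongrightarrow> h a) (at a within {-1..1})"
          using a by (intro has_vector_derivative_tendsto H') auto
        show "((\<lambda>x. E x /\<^sub>R (x - a)) \<longlongrightarrow> \<i> * pi) (at a within {-1..1})"
          using has_vector_derivative_tendsto[OF has_vector_derivative_at_within[OF E']]
          by (simp add: E_def)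
      qed auto
      moreover have "eventually (\<lambda>x. ((H x - H a) /\<^sub>R (x - a)) / (E x /\<^sub>R (x - a)) = q x) (at a within {-1..1})"
        by (auto simp: eventually_at_filter q_def scaleR_conv_of_real intro!: always_eventually)
      ultimately have "(q \<longlongrightarrow> h a / (\<i> * pi)) (at a within {-1..1})"
        by (rule Lim_transform_eventually)
      thus ?thesis by (simp add: continuous_within True q_def)
    next
      case False
      have "continuous_on {-1..1} E" unfolding E_def by (intro continuous_intros)
      hence "((\<lambda>x. (H x - H a) / E x) \<longlongrightarrow> (H x - H a) / E x) (at x within {-1..1})"
        using Hcont x Enz[OF x False] by (intro tendsto_intros) (auto simp: continuous_on_def)
      hence "((\<lambda>x. (H x - H a) / E x) \<longlongrightarrow> q x) (at x within {-1..1})"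
        using False by (simp add: q_def)
      moreover have "eventually (\<lambda>y. y \<noteq> a) (at x within {-1..1})"
        by (rule tendsto_imp_eventually_ne[OF tendsto_ident_at False])
      hence "eventually (\<lambda>y. (H y - H a) / E y = q y) (at x within {-1..1})"
        by eventually_elim (simp add: q_def)
      ultimately show ?thesis
        unfolding continuous_within by (rule Lim_transform_eventually)
    qed
    hence q: "continuous_on {-1..1} q" by (simp add: continuous_on_eq_continuous_within)
    define qh where "qh = (\<lambda>k::int. integral {-1..1} (\<lambda>x. q x * cis (- (pi * of_int k * x))))"
    \<comment> \<open>Multiplication by \<open>cis (pi * (x - a))\<close> shifts the coefficient
      index by one, so q E = H - H(a) becomes a recursion in \<open>k\<close>. It is inhomogeneous
      only at \<open>k = 0\<close>, where the constant H(a) contributes; thus the modulus is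
      constant on k >= 0 and on k <= -1. Once both constants are 0, the case \<open>k = 0\<close>
      says that H(a) is the mean \<open>M\<close>.\<close>
    have step: "qh (k - 1) * cis (- (pi * a)) - qh k = (if k = 0 then 2 * (M - H a) else 0)" for k
    proof -
      have 3: "((\<lambda>x. q x * cis (- (pi * of_int (k - 1) * x)) * cis (- (pi * a)) - q x * cis (- (pi * of_int k * x))) has_integral
         (qh (k - 1) * cis (- (pi * a)) - qh k)) {-1..1}"
        unfolding qh_def
        by (intro has_integral_diff has_integral_mult_left integrable_integral integrable_continuous_real continuous_intros q)
      have 4: "((\<lambda>x. H x * cis (- (pi * of_int k * x)) - H a * cis (pi * of_int (- k) * x)) has_integral
         (integral {-1..1} (\<lambda>x. H x * cis (- (pi * of_int k * x))) - H a * (if - k = 0 then 2 else 0))) {-1..1}"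
        by (intro has_integral_diff has_integral_mult_right has_integral_cis integrable_integral integrable_continuous_real continuous_intros Hcont)
      have 5: "q x * cis (- (pi * of_int (k - 1) * x)) * cis (- (pi * a)) - q x * cis (- (pi * of_int k * x)) =
         H x * cis (- (pi * of_int k * x)) - H a * cis (pi * of_int (- k) * x)" if "x \<in> {-1..1}" for x
      proof -
        have 1: "q x * E x = H x - H a"
          using Enz that by (auto simp: q_def E_def)
        have "cis (- (pi * of_int (k - 1) * x)) * cis (- (pi * a)) = cis (- (pi * of_int k * x)) * cis (pi * (x - a))"
          by (simp add: cis_mult algebra_simps)
        hence 2: "q x * cis (- (pi * of_int (k - 1) * x)) * cis (- (pi * a)) - q x * cis (- (pi * of_int k * x))
           = (q x * E x) * cis (- (pi * of_int k * x))"
          by (simp add: E_def algebra_simps)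
        show ?thesis unfolding 2 1 by (simp add: left_diff_distrib)
      qed
      have "qh (k - 1) * cis (- (pi * a)) - qh k =
          integral {-1..1} (\<lambda>x. H x * cis (- (pi * of_int k * x))) - H a * (if - k = 0 then 2 else 0)"
        by (rule has_integral_unique[OF has_integral_eq[OF 5 3] 4])
      thus ?thesis using Hk[of k] by (auto simp: M_def)
    qed
    have mod_eq: "cmod (qh (k - 1)) = cmod (qh k)" if "k \<noteq> 0" for k
      using step[of k] that by (metis eq_iff_diff_eq_0 mult.right_neutral norm_cis norm_mult)
    have up: "cmod (qh (int n)) = cmod (qh 0)" for n
    proof (induction n)
      case (Suc n)
      thus ?case using mod_eq[of "int (Suc n)"] by simp
    qed simp
    have down: "cmod (qh (- 1 - int n)) = cmod (qh (-1))" for n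
    proof (induction n)
      case (Suc n)
      thus ?case using mod_eq[of "- 1 - int n"] by (simp add: algebra_simps)
    qed simp
    have "infinite (range int)" "infinite (range (\<lambda>n. - 1 - int n))"
      by (intro range_inj_infinite injI; simp)+
    note const = const_fourier_coeffs_eq_0[OF q this(1), of "cmod (qh 0)"]
                 const_fourier_coeffs_eq_0[OF q this(2), of "cmod (qh (-1))"]
    have "cmod (qh 0) = 0" "cmod (qh (-1)) = 0"
      using const up down unfolding qh_def by blast+
    thus "H a = M" using step[of 0] by (simp split: if_splits)
  qed
  have h0: "h a = 0" if a: "a \<in> {-1<..<1}" for a
  proof -
    have "(H has_vector_derivative h a) (at a)"
      using H'[of a] a by (auto simp: at_within_Icc_at)
    moreover have "(H has_vector_derivative 0) (at a)"
      by (rule has_vector_derivative_transform_within_open[of "\<lambda>_. M" _ _ "{-1<..<1}"])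
         (use a Ha in auto)
    ultimately show ?thesis by (rule vector_derivative_unique_at)
  qed
  have "x \<in> closure {-1<..<1}" using x by (simp add: closure_greaterThanLessThan)
  thus ?thesis
    using continuous_constant_on_closure[of "{-1<..<1::real}" h 0 x] h h0
    by (simp add: closure_greaterThanLessThan)
qed

text \<open>For fixed \<open>l\<close> the coefficient in \<open>y\<close> is a continuous function
  of \<open>x\<close> all of whose own coefficients vanish, so it is zero; then the same argument
  applies in \<open>y\<close>.\<close>

lemma fourier_unique_2d:
  fixes g :: "real \<times> real \<Rightarrow> complex"
  assumes g: "continuous_on UNIV g"
    and coeff: "\<And>k l :: int. integral {-1..1} (\<lambda>x. integral {-1..1}
       (\<lambda>y. g (x, y) * cis (- (pi * of_int l * y))) * cis (- (pi * of_int k * x))) = 0"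
    and xy: "x \<in> {-1..1}" "y \<in> {-1..1}"
  shows "g (x, y) = 0"
proof (rule fourier_unique_1d[of "\<lambda>y. g (x, y)"])
  fix l :: int
  show "integral {-1..1} (\<lambda>y. g (x, y) * cis (- (pi * of_int l * y))) = 0"
  proof (rule fourier_unique_1d[of "\<lambda>x. integral {-1..1} (\<lambda>y. g (x, y) * cis (- (pi * of_int l * y)))"])
    show "continuous_on {- 1..1} (\<lambda>x. integral {- 1..1} (\<lambda>y. g (x, y) * cis (- (pi * of_int l * y))))"
    proof -
      have "continuous_on ({-1..1} \<times> cbox (-1) 1) (\<lambda>(x, y). g (x, y) * cis (- (pi * of_int l * y)))"
        unfolding case_prod_unfold
        by (auto intro!: continuous_intros intro: continuous_on_subset[OF g])
      from integral_continuous_on_param[OF this] show ?thesis by simp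
    qed
  qed (fact coeff xy(1))+
next
  show "continuous_on {-1..1} (\<lambda>y. g (x, y))"
    by (rule continuous_on_compose2[OF g]) (auto intro!: continuous_intros)
qed (fact xy(2))

section \<open>Mode expansions and functionals that pass through them\<close>

definition mode :: "int \<times> int \<Rightarrow> plane_fun" where
  "mode k x = cis (pi * (of_int (fst k) * fst x + of_int (snd k) * snd x))"

definition unit_square :: "(real \<times> real) set" where
  "unit_square = {-1..1} \<times> {-1..1}"

text \<open>Iterated integrals match the two applications of one-dimensional uniqueness; the link to
  the Lebesgue integral over the plane is made once, in
  \<open>fourier_coeff_eq_square_coeff\<close>.\<close>

definition square_coeff :: "plane_fun \<Rightarrow> int \<times> int \<Rightarrow> complex" where
  "square_coeff u k = integral {-1..1} (\<lambda>x. integral {-1..1}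
     (\<lambda>y. u (x, y) * cis (- (pi * of_int (snd k) * y))) * cis (- (pi * of_int (fst k) * x)))"

text \<open>Captures what is common to Fourier and Fourier-Bessel coefficients, so that sum and
  integral are interchanged by one lemma. Linearity is demanded only for continuous functions, where
  all integrals exist, and the bound sees only the values on the square.\<close>

definition bounded_functional :: "(plane_fun \<Rightarrow> complex) \<Rightarrow> bool" where
  "bounded_functional \<Lambda> \<longleftrightarrow>
     (\<forall>u v a. continuous_on UNIV u \<longrightarrow> continuous_on UNIV v \<longrightarrow> \<Lambda> (\<lambda>x. a * u x + v x) = a * \<Lambda> u + \<Lambda> v) \<and>
     (\<exists>C. \<forall>u B. continuous_on UNIV u \<longrightarrow> (\<forall>x\<in>unit_square. cmod (u x) \<le> B) \<longrightarrow> cmod (\<Lambda> u) \<le> C * B)"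

lemma norm_mode [simp]: "cmod (mode k x) = 1"
  by (simp add: mode_def)

lemma continuous_on_mode [continuous_intros]: "continuous_on S (mode k)"
  unfolding mode_def by (intro continuous_intros)

lemma bounded_functional_linear:
  assumes "bounded_functional \<Lambda>" "continuous_on UNIV u" "continuous_on UNIV v"
  shows "\<Lambda> (\<lambda>x. a * u x + v x) = a * \<Lambda> u + \<Lambda> v"
  using assms unfolding bounded_functional_def by blast

lemma bounded_functional_sum:
  assumes \<Lambda>: "bounded_functional \<Lambda>" and e: "\<And>k. k \<in> F \<Longrightarrow> continuous_on UNIV (e k)"
  shows "\<Lambda> (\<lambda>x. \<Sum>k\<in>F. a k * e k x) = (\<Sum>k\<in>F. a k * \<Lambda> (e k))"
proof -
  have zero: "\<Lambda> (\<lambda>x. 0) = 0"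
    using bounded_functional_linear[OF \<Lambda>, of "\<lambda>x. 0" "\<lambda>x. 0" 1] by simp
  show ?thesis
    using e
  proof (induction F rule: infinite_finite_induct)
    case (insert k F)
    thus ?case
      by (simp add: bounded_functional_linear[OF \<Lambda>] continuous_intros)
  qed (auto simp: zero)
qed

text \<open>Absolute summability of \<open>a\<close> makes the partial sums converge uniformly on
  the square by the Weierstrass test, and the bound in the definition carries uniform convergence
  over to the values of the functional.\<close>

lemma bounded_functional_has_sum:
  assumes \<Lambda>: "bounded_functional \<Lambda>" and e: "\<And>k. continuous_on UNIV (e k)" "\<And>k x. x \<in> unit_square \<Longrightarrow> cmod (e k x) \<le> 1"
    and a: "(\<lambda>k. cmod (a k)) summable_on UNIV"
    and u: "continuous_on UNIV u" "\<And>x. x \<in> unit_square \<Longrightarrow> ((\<lambda>k. a k * e k x) has_sum u x) UNIV"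
  shows "((\<lambda>k. a k * \<Lambda> (e k)) has_sum \<Lambda> u) UNIV"
proof -
  obtain C where C: "\<And>u B. continuous_on UNIV u \<Longrightarrow> (\<And>x. x \<in> unit_square \<Longrightarrow> cmod (u x) \<le> B) \<Longrightarrow> cmod (\<Lambda> u) \<le> C * B"
    using \<Lambda> unfolding bounded_functional_def by blast
  have lim: "uniform_limit unit_square (\<lambda>F x. \<Sum>k\<in>F. a k * e k x) u (finite_subsets_at_top UNIV)"
    by (rule Weierstrass_m_test_general'[OF _ u(2) a])
       (auto simp: norm_mult intro!: mult_left_le e)
  show ?thesis
    unfolding has_sum_def bounded_functional_sum[OF \<Lambda> e(1), symmetric]
  proof (rule tendstoI)
    fix r :: real assume r: "r > 0"
    define d where "d = r / (\<bar>C\<bar> + 1)"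
    have d: "d > 0" using r by (simp add: d_def)
    show "\<forall>\<^sub>F F in finite_subsets_at_top UNIV. dist (\<Lambda> (\<lambda>x. \<Sum>k\<in>F. a k * e k x)) (\<Lambda> u) < r"
      using uniform_limitD[OF lim d]
    proof eventually_elim
      case (elim F)
      let ?S = "\<lambda>x. \<Sum>k\<in>F. a k * e k x"
      have S: "continuous_on UNIV ?S" by (intro continuous_intros e)
      have "cmod (\<Lambda> (\<lambda>x. (-1) * u x + ?S x)) \<le> C * d"
      proof (rule C)
        show "cmod (- 1 * u x + ?S x) \<le> d" if "x \<in> unit_square" for x
          using elim that by (auto simp: dist_norm less_imp_le)
      qed (intro continuous_intros u S)
      also have "\<Lambda> (\<lambda>x. (-1) * u x + ?S x) = \<Lambda> ?S - \<Lambda> u"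
        using bounded_functional_linear[OF \<Lambda> u(1) S, of "-1"] by simp
      also have "C * d < r"
      proof -
        have "C * d \<le> \<bar>C\<bar> * d" using d by (intro mult_right_mono) auto
        also have "\<dots> < (\<bar>C\<bar> + 1) * d" using d by (simp add: distrib_right)
        also have "\<dots> = r" by (simp add: d_def add_nonneg_eq_0_iff)
        finally show ?thesis .
      qed
      finally show ?case by (simp add: dist_norm)
    qed
  qed
qed

text \<open>One template for two coordinate systems: \<open>p\<close> is the parametrisation of the
  integration domain, Cartesian for \<open>square_coeff\<close> and polar for
  \<open>FB_coeff\<close>, and \<open>w\<close> collects the kernel and the Jacobian.\<close>

lemma bounded_functional_iterated:
  fixes p :: "real \<Rightarrow> real \<Rightarrow> real \<times> real" and w :: "real \<Rightarrow> real \<Rightarrow> complex"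
  assumes p: "continuous_on ({a..b} \<times> {c..d}) (\<lambda>(s, t). p s t)"
    and w: "continuous_on ({a..b} \<times> {c..d}) (\<lambda>(s, t). w s t)"
    and ps: "\<And>s t. s \<in> {a..b} \<Longrightarrow> t \<in> {c..d} \<Longrightarrow> p s t \<in> unit_square"
    and ab: "a \<le> b" "c \<le> d"
  shows "bounded_functional (\<lambda>u. integral {a..b} (\<lambda>s. integral {c..d} (\<lambda>t. u (p s t) * w s t)))"
proof -
  have cont: "continuous_on ({a..b} \<times> {c..d}) (\<lambda>(s, t). u (p s t) * w s t)" if "continuous_on UNIV u" for u :: plane_fun
    using p w continuous_on_compose2[OF that p] unfolding case_prod_unfold by (intro continuous_intros) auto
  have inner: "continuous_on {c..d} (\<lambda>t. u (p s t) * w s t)" if "continuous_on UNIV u" "s \<in> {a..b}" for s and u :: plane_fun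
  proof -
    have "continuous_on {c..d} (\<lambda>t. (s, t))" by (intro continuous_intros)
    from continuous_on_compose2[OF cont[OF that(1)] this] show ?thesis using that(2) by (simp add: image_subset_iff)
  qed
  have outer: "continuous_on {a..b} (\<lambda>s. integral {c..d} (\<lambda>t. u (p s t) * w s t))" if "continuous_on UNIV u" for u :: plane_fun
    using integral_continuous_on_param[of "{a..b}" c d "\<lambda>s t. u (p s t) * w s t"] cont[OF that] by simp
  have "compact ((\<lambda>(s, t). w s t) ` ({a..b} \<times> {c..d}))"
    by (intro compact_continuous_image w compact_Times) auto
  then obtain W where W': "\<forall>z\<in>(\<lambda>(s, t). w s t) ` ({a..b} \<times> {c..d}). cmod z \<le> W"
    using compact_imp_bounded bounded_iff by metis
  have W: "cmod (w s t) \<le> W" if "s \<in> {a..b}" "t \<in> {c..d}" for s t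
    using W' that by auto
  have "W \<ge> 0" using order_trans[OF norm_ge_zero W[of a c]] ab by simp
  show ?thesis
    unfolding bounded_functional_def
  proof (intro conjI allI impI exI)
    fix u v :: plane_fun and z :: complex
    assume u: "continuous_on UNIV u" and v: "continuous_on UNIV v"
    have "integral {c..d} (\<lambda>t. (z * u (p s t) + v (p s t)) * w s t) =
        z * integral {c..d} (\<lambda>t. u (p s t) * w s t) + integral {c..d} (\<lambda>t. v (p s t) * w s t)" if "s \<in> {a..b}" for s
    proof -
      have "((\<lambda>t. z * (u (p s t) * w s t) + v (p s t) * w s t) has_integral
        z * integral {c..d} (\<lambda>t. u (p s t) * w s t) + integral {c..d} (\<lambda>t. v (p s t) * w s t)) {c..d}"
        by (intro has_integral_add has_integral_mult_right integrable_integral integrable_continuous_real inner u v that)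
      thus ?thesis by (simp add: algebra_simps integral_unique)
    qed
    hence "integral {a..b} (\<lambda>s. integral {c..d} (\<lambda>t. (z * u (p s t) + v (p s t)) * w s t)) =
      integral {a..b} (\<lambda>s. z * integral {c..d} (\<lambda>t. u (p s t) * w s t) + integral {c..d} (\<lambda>t. v (p s t) * w s t))"
      by (intro integral_cong) auto
    also have "\<dots> = z * integral {a..b} (\<lambda>s. integral {c..d} (\<lambda>t. u (p s t) * w s t)) +
        integral {a..b} (\<lambda>s. integral {c..d} (\<lambda>t. v (p s t) * w s t))"
      by (intro integral_unique has_integral_add has_integral_mult_right integrable_integral integrable_continuous_real outer u v)
    finally show "integral {a..b} (\<lambda>s. integral {c..d} (\<lambda>t. (z * u (p s t) + v (p s t)) * w s t)) =
        z * integral {a..b} (\<lambda>s. integral {c..d} (\<lambda>t. u (p s t) * w s t)) +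
        integral {a..b} (\<lambda>s. integral {c..d} (\<lambda>t. v (p s t) * w s t))" .
  next
    fix u :: plane_fun and B
    assume u: "continuous_on UNIV u" and B: "\<forall>x\<in>unit_square. cmod (u x) \<le> B"
    have "cmod (integral {a..b} (\<lambda>s. integral {c..d} (\<lambda>t. u (p s t) * w s t))) \<le> (B * W * (d - c)) * (b - a)"
    proof (rule integral_bound[OF ab(1) outer[OF u]])
      fix s assume s: "s \<in> {a..b}"
      show "cmod (integral {c..d} (\<lambda>t. u (p s t) * w s t)) \<le> B * W * (d - c)"
      proof (rule integral_bound[OF ab(2) inner[OF u s]])
        fix t assume t: "t \<in> {c..d}"
        have "cmod (u (p s t)) \<le> B" using B ps[OF s t] by blast
        thus "cmod (u (p s t) * w s t) \<le> B * W"
          unfolding norm_mult using W[OF s t] order_trans[OF norm_ge_zero \<open>cmod (u (p s t)) \<le> B\<close>]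
          by (intro mult_mono) auto
      qed
    qed
    thus "cmod (integral {a..b} (\<lambda>s. integral {c..d} (\<lambda>t. u (p s t) * w s t))) \<le> (W * (d - c) * (b - a)) * B"
      by (simp add: mult_ac)
  qed
qed

lemma bounded_functional_square_coeff: "bounded_functional (\<lambda>u. square_coeff u k)"
proof -
  have "square_coeff u k = integral {-1..1} (\<lambda>x. integral {-1..1}
     (\<lambda>y. u (x, y) * (cis (- (pi * of_int (snd k) * y)) * cis (- (pi * of_int (fst k) * x)))))" for u
    unfolding square_coeff_def by (simp add: mult.assoc flip: integral_mult_left)
  moreover have "bounded_functional (\<lambda>u. integral {-1..1} (\<lambda>x. integral {-1..1}
     (\<lambda>y. u (x, y) * (cis (- (pi * of_int (snd k) * y)) * cis (- (pi * of_int (fst k) * x))))))"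
    by (rule bounded_functional_iterated)
       (auto simp: unit_square_def case_prod_unfold intro!: continuous_intros)
  ultimately show ?thesis by simp
qed

lemma square_coeff_mode: "square_coeff (mode j) k = (if j = k then 4 else 0)"
proof -
  have I: "integral {-1..1} (\<lambda>x. cis (pi * of_int k * x)) = (if k = 0 then 2 else 0)" for k :: int
    by (rule integral_unique[OF has_integral_cis])
  have "mode j (x, y) * cis (- (pi * of_int (snd k) * y)) =
      cis (pi * of_int (fst j) * x) * cis (pi * of_int (snd j - snd k) * y)" for x y
    by (simp add: mode_def cis_mult algebra_simps)
  hence "integral {-1..1} (\<lambda>y. mode j (x, y) * cis (- (pi * of_int (snd k) * y))) =
      cis (pi * of_int (fst j) * x) * (if snd j - snd k = 0 then 2 else 0)" for x
    by (simp only: integral_mult_right I)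
  moreover have "cis (pi * of_int (fst j) * x) * z * cis (- (pi * of_int (fst k) * x)) =
      z * cis (pi * of_int (fst j - fst k) * x)" for x z
  proof -
    have "cis (pi * of_int (fst j - fst k) * x) = cis (pi * of_int (fst j) * x) * cis (- (pi * of_int (fst k) * x))"
      by (simp add: cis_mult algebra_simps)
    thus ?thesis by simp
  qed
  ultimately have "square_coeff (mode j) k = (if snd j - snd k = 0 then 2 else 0) * (if fst j - fst k = 0 then 2 else 0)"
    by (simp only: square_coeff_def integral_mult_right I)
  thus ?thesis
    by (simp add: prod_eq_iff)
qed

lemma continuous_on_absolutely_convergent_modes:
  assumes "(\<lambda>k. cmod (a k)) summable_on UNIV"
  shows "continuous_on UNIV (\<lambda>x. \<Sum>\<^sub>\<infinity>k. a k * mode k x)"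
proof (rule uniform_limit_theorem)
  show "uniform_limit UNIV (\<lambda>F x. \<Sum>k\<in>F. a k * mode k x) (\<lambda>x. \<Sum>\<^sub>\<infinity>k. a k * mode k x) (finite_subsets_at_top UNIV)"
    by (rule Weierstrass_m_test_general[OF _ assms]) (auto simp: norm_mult)
qed (auto intro!: always_eventually continuous_intros)

text \<open>The sum \<open>s\<close> of the series is continuous and, integrating termwise with
  orthogonality of the modes, has the same coefficients as \<open>f\<close>; uniqueness gives s = f
  on the square. The 4 is the area of the square.\<close>

lemma fourier_inversion:
  assumes f: "continuous_on UNIV f" and a: "(\<lambda>k. cmod (square_coeff f k)) summable_on UNIV"
    and x: "x \<in> unit_square"
  shows "((\<lambda>k. (square_coeff f k / 4) * mode k x) has_sum f x) UNIV"
proof -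
  define b where "b = (\<lambda>k. square_coeff f k / 4)"
  have b: "(\<lambda>k. cmod (b k)) summable_on UNIV"
    using summable_on_cmult_right[OF a, of "1 / 4"] by (simp add: b_def norm_divide)
  define s where "s = (\<lambda>x. \<Sum>\<^sub>\<infinity>k. b k * mode k x)"
  have s: "continuous_on UNIV s"
    unfolding s_def by (rule continuous_on_absolutely_convergent_modes[OF b])
  have sum: "((\<lambda>k. b k * mode k x) has_sum s x) UNIV" for x
    unfolding s_def
    by (rule has_sum_infsum, rule abs_summable_summable) (use b in \<open>simp add: norm_mult\<close>)
  have coeff: "square_coeff s j = square_coeff f j" for j
  proof -
    have "((\<lambda>k. b k * square_coeff (mode k) j) has_sum square_coeff s j) UNIV"
      by (rule bounded_functional_has_sum[OF bounded_functional_square_coeff continuous_on_mode _ b s sum]) simp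
    moreover have "((\<lambda>k. b k * square_coeff (mode k) j) has_sum b j * square_coeff (mode j) j) UNIV"
      by (rule has_sum_finite_neutralI[of "{j}"]) (auto simp: square_coeff_mode)
    ultimately have "square_coeff s j = b j * square_coeff (mode j) j"
      by (rule has_sum_unique)
    thus ?thesis by (simp add: square_coeff_mode b_def)
  qed
  have "(\<lambda>x. (-1) * s x + f x) (fst x, snd x) = 0"
  proof (rule fourier_unique_2d)
    show "continuous_on UNIV (\<lambda>x. (-1) * s x + f x)" by (intro continuous_intros s f)
    show "integral {-1..1} (\<lambda>x. integral {-1..1} (\<lambda>y. (- 1 * s (x, y) + f (x, y)) * cis (- (pi * of_int l * y))) *
            cis (- (pi * of_int k * x))) = 0" for k l :: int
      using bounded_functional_linear[OF bounded_functional_square_coeff s f, of "-1" "(k, l)"] coeff[of "(k, l)"]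
      by (simp add: square_coeff_def)
  qed (use x in \<open>auto simp: unit_square_def\<close>)
  thus ?thesis using sum[of x] by (simp add: b_def)
qed

section \<open>Fourier coefficients of functions supported in the open disk, and their
  quadrature\<close>

lemma support_ball_eq_0:
  assumes "support_on UNIV f \<subseteq> ball (0::real \<times> real) 1" "\<bar>x\<bar> \<ge> 1 \<or> \<bar>y\<bar> \<ge> 1"
  shows "f (x, y) = 0"
proof (rule ccontr)
  assume "f (x, y) \<noteq> 0"
  hence "norm (x, y) < 1" using assms(1) by (auto simp: support_on_def)
  thus False using assms(2) norm_fst_le[of x y] norm_snd_le[of y x] by auto
qed

text \<open>The integrand vanishes off the square, where it is continuous, so Fubini
  applies.\<close>

lemma fourier_coeff_eq_square_coeff:
  assumes f: "continuous_on UNIV f" and supp: "support_on UNIV f \<subseteq> ball 0 1"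
  shows "fourier_coeff f k = square_coeff f k"
proof -
  define F where "F = (\<lambda>x. f x * exp (- \<i> * of_real (pi * (of_int (fst k) * fst x + of_int (snd k) * snd x))))"
  have F: "continuous_on S F" for S
    unfolding F_def by (intro continuous_intros continuous_on_subset[OF f]) auto
  have "F x = 0" if "x \<notin> cbox (-1, -1) (1, 1)" for x
    using support_ball_eq_0[OF supp, of "fst x" "snd x"] that by (cases x) (auto simp: F_def)
  hence "fourier_coeff f k = (LINT x:cbox (-1, -1) (1, 1)|lebesgue. F x)"
    unfolding fourier_coeff_def F_def[symmetric] set_lebesgue_integral_def
    by (intro Bochner_Integration.integral_cong) (auto simp: indicator_def)
  also have "\<dots> = integral (cbox (-1, -1) (1, 1)) F"
    by (intro set_lebesgue_integral_eq_integral absolutely_integrable_continuous F)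
  also have "\<dots> = integral {-1..1} (\<lambda>x. integral {-1..1} (\<lambda>y. F (x, y)))"
    using integral_prod_continuous[of "-1" "-1" 1 1 F, OF F] by simp
  also have "\<dots> = square_coeff f k"
  proof -
    have "F (x, y) = f (x, y) * cis (- (pi * of_int (snd k) * y)) * cis (- (pi * of_int (fst k) * x))" for x y
      by (simp add: F_def cis_conv_exp exp_add[symmetric] algebra_simps)
    thus ?thesis by (simp add: square_coeff_def)
  qed
  finally show ?thesis .
qed

lemma C1_lipschitz_on_square:
  assumes "f \<in> C_space 1"
  obtains B where "B \<ge> 0"
    "\<And>x x' y. x \<in> {-1..1} \<Longrightarrow> x' \<in> {-1..1} \<Longrightarrow> y \<in> {-1..1} \<Longrightarrow> cmod (f (x, y) - f (x', y)) \<le> B * \<bar>x - x'\<bar>"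
    "\<And>x y y'. x \<in> {-1..1} \<Longrightarrow> y \<in> {-1..1} \<Longrightarrow> y' \<in> {-1..1} \<Longrightarrow> cmod (f (x, y) - f (x, y')) \<le> B * \<bar>y - y'\<bar>"
proof -
  from assms have "continuous_on UNIV f \<and> (\<exists>f1. continuous_on UNIV f1 \<and> (\<exists>f2. continuous_on UNIV f2 \<and>
    (\<forall>x y. ((\<lambda>t. f (t, y)) has_vector_derivative f1 (x, y)) (at x) \<and>
           ((\<lambda>t. f (x, t)) has_vector_derivative f2 (x, y)) (at y))))"
    by (simp add: Bex_def)
  then obtain f1 f2 where f: "continuous_on UNIV f" "continuous_on UNIV f1" "continuous_on UNIV f2"
    "\<forall>x y. ((\<lambda>t. f (t, y)) has_vector_derivative f1 (x, y)) (at x) \<and>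
           ((\<lambda>t. f (x, t)) has_vector_derivative f2 (x, y)) (at y)"
    by (elim exE conjE)
  have "\<exists>B. \<forall>z\<in>{-1..1} \<times> {-1..1}. cmod (g z) \<le> B" if "continuous_on UNIV g" for g :: plane_fun
  proof -
    have "bounded (g ` ({-1..1} \<times> {-1..1}))"
      by (intro compact_imp_bounded compact_continuous_image compact_Times continuous_on_subset[OF that]) auto
    thus ?thesis by (simp add: bounded_iff)
  qed
  from this[OF f(2)] this[OF f(3)] obtain B1 B2
    where B: "\<forall>z\<in>{-1..1} \<times> {-1..1}. cmod (f1 z) \<le> B1" "\<forall>z\<in>{-1..1} \<times> {-1..1}. cmod (f2 z) \<le> B2"
    by (elim exE)
  define B where "B = max 0 (max B1 B2)"
  have lip: "cmod (g x - g x') \<le> B * \<bar>x - x'\<bar>"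
    if "\<And>x. (g has_vector_derivative g' x) (at x)" "\<And>x. x \<in> {-1..1} \<Longrightarrow> cmod (g' x) \<le> B" "x \<in> {-1..1}" "x' \<in> {-1..1}"
    for g g' :: "real \<Rightarrow> complex" and x x'
  proof -
    have "norm (g x - g x') \<le> B * norm (x - x')"
    proof (rule differentiable_bound[of "{-1..1}"])
      show "(g has_derivative (\<lambda>h. h *\<^sub>R g' x)) (at x within {-1..1})" for x
        using has_vector_derivative_at_within[OF that(1)] by (simp add: has_vector_derivative_def)
      show "onorm (\<lambda>h. h *\<^sub>R g' x) \<le> B" if "x \<in> {-1..1}" for x
        using \<open>\<And>x. x \<in> {-1..1} \<Longrightarrow> cmod (g' x) \<le> B\<close>[OF that] by (intro onorm_le) (metis mult.commute mult_right_mono norm_ge_zero norm_scaleR real_norm_def)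
    qed (use that in auto)
    thus ?thesis by simp
  qed
  show thesis
  proof
    show "B \<ge> 0" by (simp add: B_def)
    fix x y z :: real assume xyz: "x \<in> {-1..1}" "y \<in> {-1..1}" "z \<in> {-1..1}"
    show "cmod (f (x, z) - f (y, z)) \<le> B * \<bar>x - y\<bar>"
      using xyz f(4) B(1) by (intro lip[of "\<lambda>t. f (t, z)" "\<lambda>t. f1 (t, z)"]) (auto simp: B_def le_max_iff_disj)
    show "cmod (f (x, y) - f (x, z)) \<le> B * \<bar>y - z\<bar>"
      using xyz f(4) B(2) by (intro lip[of "\<lambda>t. f (x, t)" "\<lambda>t. f2 (x, t)"]) (auto simp: B_def le_max_iff_disj)
  qed
qed

text \<open>The one-dimensional estimate is applied twice: in \<open>y\<close> for each grid value
  of \<open>x\<close>, then in \<open>x\<close> to the inner integral \<open>I\<close>, which is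
  Lipschitz with constant 2 B because the \<open>y\<close>-interval has length 2. The bound is
  uniform in \<open>k\<close> within the stated frequency range.\<close>

lemma finite_fourier_error:
  assumes f: "f \<in> C_space 1" and supp: "support_on UNIV f \<subseteq> ball 0 1"
  obtains C where "C > 0"
    "\<And>L k. L \<ge> 1 \<Longrightarrow> 2 * \<bar>fst k\<bar> \<le> int L \<Longrightarrow> 2 * \<bar>snd k\<bar> \<le> int L \<Longrightarrow>
       cmod (finite_fourier L f k - fourier_coeff f k) \<le> C / real L"
proof -
  obtain B where B: "B \<ge> 0"
    "\<And>x x' y. x \<in> {-1..1} \<Longrightarrow> x' \<in> {-1..1} \<Longrightarrow> y \<in> {-1..1} \<Longrightarrow> cmod (f (x, y) - f (x', y)) \<le> B * \<bar>x - x'\<bar>"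
    "\<And>x y y'. x \<in> {-1..1} \<Longrightarrow> y \<in> {-1..1} \<Longrightarrow> y' \<in> {-1..1} \<Longrightarrow> cmod (f (x, y) - f (x, y')) \<le> B * \<bar>y - y'\<bar>"
    using C1_lipschitz_on_square[OF f] by blast
  have fcont: "continuous_on UNIV f" using f by simp
  \<comment> \<open>On the sides of the square \<open>f\<close> vanishes; this supplies the endpoint
    conditions of \<open>quadrature_error\<close> for \<open>f\<close> and for
    \<open>I\<close>.\<close>
  note zero = support_ball_eq_0[OF supp]
  show thesis
  proof
    \<comment> \<open>24 B comes from the inner quadrature (\<open>L\<close> errors 12 B / L
      weighted by 2 / L) and 24 B from the outer one; the 1 keeps the constant positive when
      \<open>B\<close> is 0.\<close>
    show "48 * B + 1 > 0" using B(1) by simp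
    fix L :: nat and k :: "int \<times> int"
    assume L: "L \<ge> 1" and k: "2 * \<bar>fst k\<bar> \<le> int L" "2 * \<bar>snd k\<bar> \<le> int L"
    have freq: "2 * \<bar>- (pi * real_of_int l)\<bar> \<le> pi * real L" if "2 * \<bar>l\<bar> \<le> int L" for l
    proof -
      have "real_of_int (2 * \<bar>l\<bar>) \<le> real L" using that by linarith
      hence "pi * (2 * \<bar>real_of_int l\<bar>) \<le> pi * real L" by (intro mult_left_mono) auto
      thus ?thesis by (simp add: abs_mult mult_ac)
    qed
    let ?e1 = "\<lambda>x. cis (- (pi * of_int (fst k)) * x)" and ?e2 = "\<lambda>y. cis (- (pi * of_int (snd k)) * y)"
    let ?x = "grid_point L"
    define d where "d = complex_of_real (2 / real L)"
    define I where "I = (\<lambda>x. integral {-1..1} (\<lambda>y. f (x, y) * ?e2 y))"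
    define Q where "Q = (\<lambda>x. d * (\<Sum>j\<in>{1..L}. f (x, ?x j) * ?e2 (?x j)))"
    have d: "cmod d = 2 / real L" by (simp add: d_def norm_divide)
    have xin: "?x i \<in> {-1..1}" if "i \<in> {1..L}" for i
    proof -
      have "(real i - 1) * (2 / real L) \<le> real L * (2 / real L)"
        using that by (intro mult_right_mono) auto
      thus ?thesis using that L by (auto simp: grid_point_def)
    qed
    have QI: "cmod (Q x - I x) \<le> 12 * B / real L" if x: "x \<in> {-1..1}" for x
      unfolding Q_def I_def d_def
      by (rule quadrature_error[OF _ _ _ L freq[OF k(2)] B(1)]) (use B(3) x zero in auto)
    have fc: "continuous_on {-1..1} (\<lambda>y. f (x, y) * ?e2 y)" for x
      by (intro continuous_intros continuous_on_compose2[OF fcont]) auto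
    have I_lip: "cmod (I x - I x') \<le> (2 * B) * \<bar>x - x'\<bar>" if x: "x \<in> {-1..1}" "x' \<in> {-1..1}" for x x'
    proof -
      have "I x - I x' = integral {-1..1} (\<lambda>y. f (x, y) * ?e2 y - f (x', y) * ?e2 y)"
        unfolding I_def
        by (intro Henstock_Kurzweil_Integration.integral_diff[symmetric] integrable_continuous_real fc)
      also have "cmod \<dots> \<le> (B * \<bar>x - x'\<bar>) * (1 - (-1))"
      proof (rule integral_bound)
        show "continuous_on {-1..1} (\<lambda>y. f (x, y) * ?e2 y - f (x', y) * ?e2 y)"
          by (intro continuous_on_diff fc)
        fix y :: real assume "y \<in> {-1..1}"
        thus "cmod (f (x, y) * ?e2 y - f (x', y) * ?e2 y) \<le> B * \<bar>x - x'\<bar>"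
          using B(2)[of x x' y] x by (simp add: norm_mult flip: left_diff_distrib)
      qed auto
      finally show ?thesis by simp
    qed
    have IJ: "cmod (d * (\<Sum>i\<in>{1..L}. I (?x i) * ?e1 (?x i)) - integral {-1..1} (\<lambda>x. I x * ?e1 x)) \<le> 12 * (2 * B) / real L"
      unfolding d_def
      by (rule quadrature_error[OF I_lip _ _ L freq[OF k(1)]]) (use B(1) zero in \<open>auto simp: I_def\<close>)
    have "finite_fourier L f k = d * (\<Sum>i\<in>{1..L}. Q (?x i) * ?e1 (?x i))"
    proof -
      have "exp (- of_real pi * \<i> * of_real (of_int (fst k) * x + of_int (snd k) * y)) = ?e2 y * ?e1 x" for x y
        by (simp add: cis_conv_exp exp_add[symmetric] algebra_simps)
      thus ?thesis
        unfolding finite_fourier_def Q_def d_def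
        by (simp only:) (simp add: sum_distrib_left sum_distrib_right power2_eq_square mult_ac)
    qed
    moreover have "fourier_coeff f k = integral {-1..1} (\<lambda>x. I x * ?e1 x)"
      by (simp add: fourier_coeff_eq_square_coeff[OF fcont supp] square_coeff_def I_def)
    ultimately have "finite_fourier L f k - fourier_coeff f k = d * (\<Sum>i\<in>{1..L}. (Q (?x i) - I (?x i)) * ?e1 (?x i)) +
        (d * (\<Sum>i\<in>{1..L}. I (?x i) * ?e1 (?x i)) - integral {-1..1} (\<lambda>x. I x * ?e1 x))"
      by (simp add: left_diff_distrib sum_subtractf right_diff_distrib)
    also have "cmod \<dots> \<le> cmod d * (\<Sum>i\<in>{1..L}. 12 * B / real L) + 12 * (2 * B) / real L"
    proof (rule order_trans[OF norm_triangle_ineq add_mono[OF _ IJ]], unfold norm_mult, rule mult_left_mono)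
      show "cmod (\<Sum>i\<in>{1..L}. (Q (?x i) - I (?x i)) * ?e1 (?x i)) \<le> (\<Sum>i\<in>{1..L}. 12 * B / real L)"
        using QI xin by (intro sum_norm_le) (auto simp: norm_mult)
    qed auto
    also have "\<dots> = 48 * B / real L"
      using L by (simp add: d field_simps)
    also have "\<dots> \<le> (48 * B + 1) / real L"
      by (intro divide_right_mono) auto
    finally show "cmod (finite_fourier L f k - fourier_coeff f k) \<le> (48 * B + 1) / real L" .
  qed
qed

section \<open>Bessel functions of integer order\<close>

text \<open>The entire factor in J_m(x) = (x/2)^m g_m((x/2)^2). Splitting off the power makes
  differentiation a pure shift of the index, g_m' = -g_(m+1), also at the origin.\<close>

definition bessel_g :: "nat \<Rightarrow> real \<Rightarrow> real" where
  "bessel_g m s = (\<Sum>j. (-1) ^ j / (fact j * fact (m + j)) * s ^ j)"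

lemma bessel_g_summable: "summable (\<lambda>j. (-1) ^ j / (fact j * fact (m + j)) * (s::real) ^ j)"
proof (rule summable_comparison_test)
  show "summable (\<lambda>j. inverse (fact j) * \<bar>s\<bar> ^ j)"
    by (rule summable_exp)
  have "\<bar>(-1) ^ j / (fact j * fact (m + j)) * s ^ j\<bar> \<le> inverse (fact j) * \<bar>s\<bar> ^ j" for j
  proof -
    have "inverse (fact j) * inverse (fact (m + j)) \<le> inverse (fact j) * (1::real)"
      by (intro mult_left_mono) (auto simp: inverse_le_1_iff)
    thus ?thesis
      by (auto simp: abs_mult power_abs divide_inverse intro!: mult_right_mono mult_left_le_one_le)
  qed
  thus "\<exists>N. \<forall>j\<ge>N. norm ((-1) ^ j / (fact j * fact (m + j)) * s ^ j) \<le> inverse (fact j) * \<bar>s\<bar> ^ j"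
    by auto
qed

lemma bessel_g_sums: "(\<lambda>j. (-1) ^ j / (fact j * fact (m + j)) * s ^ j) sums bessel_g m s"
  unfolding bessel_g_def using bessel_g_summable by (rule summable_sums)

lemma bessel_g_deriv: "(bessel_g m has_real_derivative - bessel_g (Suc m) s) (at s)"
proof -
  let ?c = "\<lambda>m j. (-1) ^ j / (fact j * fact (m + j)) :: real"
  have "((\<lambda>s. \<Sum>j. ?c m j * s ^ j) has_real_derivative (\<Sum>j. diffs (?c m) j * s ^ j)) (at s)"
    by (rule termdiffs_strong_converges_everywhere) (rule bessel_g_summable)
  moreover have "diffs (?c m) j = - ?c (Suc m) j" for j
    by (simp add: diffs_def divide_simps)
  ultimately show ?thesis
    using suminf_minus[OF bessel_g_summable[of "Suc m" s]]
    by (simp add: bessel_g_def[abs_def])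
qed

text \<open>Comparison of coefficients after splitting m + j + 1 into m + 1 and j; the
  \<open>j\<close> part, reindexed by one power in \<open>e\<close>, is the last series. It is the
  three-term recurrence for J_m, J_(m+1), J_(m+2) freed of the division by x.\<close>

lemma bessel_g_rec: "bessel_g m s = (real m + 1) * bessel_g (Suc m) s - s * bessel_g (Suc (Suc m)) s"
proof -
  let ?c = "\<lambda>m j. (-1) ^ j / (fact j * fact (m + j)) :: real"
  define e where "e = (\<lambda>j. case j of 0 \<Rightarrow> 0 | Suc i \<Rightarrow> - s * (?c (Suc (Suc m)) i * s ^ i))"
  have "(\<lambda>i. e (Suc i)) sums (- s * bessel_g (Suc (Suc m)) s)"
    unfolding e_def nat.case by (intro sums_mult bessel_g_sums)
  hence "e sums (- s * bessel_g (Suc (Suc m)) s)"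
    by (subst (asm) sums_Suc_iff) (simp add: e_def)
  hence "(\<lambda>j. (real m + 1) * (?c (Suc m) j * s ^ j) + e j) sums
      ((real m + 1) * bessel_g (Suc m) s + - s * bessel_g (Suc (Suc m)) s)"
    by (intro sums_add sums_mult bessel_g_sums)
  moreover have "(real m + 1) * (?c (Suc m) j * s ^ j) + e j = ?c m j * s ^ j" for j
  proof (cases j)
    case (Suc i)
    have "(fact (Suc (Suc (m + i))) :: real) = (real m + real i + 2) * ((real m + real i + 1) * fact (m + i))"
         "(fact (Suc (m + i)) :: real) = (real m + real i + 1) * fact (m + i)"
         "(fact (Suc i) :: real) = (real i + 1) * fact i"
      by (simp_all add: algebra_simps)
    note f = this
    show ?thesis
      unfolding Suc e_def nat.case add_Suc add_Suc_right f
      by (simp add: divide_simps del: fact_Suc) (simp add: algebra_simps)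
  qed (simp add: e_def divide_simps add.commute)
  ultimately show ?thesis
    using bessel_g_sums[of m s] by (simp add: sums_iff)
qed

lemma bessel_J_nat: "bessel_J (int m) x = (x / 2) ^ m * bessel_g m ((x / 2)\<^sup>2)"
proof -
  have "rGamma (real_of_int (int m + int j + 1)) = 1 / fact (m + j)" for j
    using Gamma_fact[of "m + j", where ?'a = real] by (simp add: rGamma_inverse_Gamma divide_inverse add_ac)
  moreover have "(x / 2) powi (2 * int j + int m) = (x / 2) ^ m * ((x / 2)\<^sup>2) ^ j" for j
  proof -
    have "2 * int j + int m = int (m + 2 * j)" by simp
    thus ?thesis by (simp only: power_int_of_nat power_add power_mult)
  qed
  ultimately have "bessel_J (int m) x = (\<Sum>j. (x / 2) ^ m * ((-1) ^ j / (fact j * fact (m + j)) * ((x / 2)\<^sup>2) ^ j))"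
    by (simp add: bessel_J_def mult_ac)
  thus ?thesis
    by (simp only: suminf_mult[OF bessel_g_summable] bessel_g_def)
qed

text \<open>The first \<open>m\<close> terms vanish because \<open>rGamma\<close> is zero at
  nonpositive integers; shifting the index by \<open>m\<close> turns the rest into the series of
  positive order with the sign (-1)^m.\<close>

lemma bessel_J_uminus: "bessel_J (- int m) x = (-1) ^ m * bessel_J (int m) x"
proof -
  define a where "a = (\<lambda>j. (-1) ^ j / fact j * rGamma (real_of_int (- int m + int j + 1)) * (x / 2) powi (2 * int j + - int m))"
  have zero: "a j = 0" if "j < m" for j
  proof -
    have "real_of_int (- int m + int j + 1) \<in> \<int>\<^sub>\<le>\<^sub>0"
      using that by (intro nonpos_Ints_of_int) auto
    thus ?thesis by (simp add: a_def rGamma_eq_zero_iff)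
  qed
  have shift: "a (j + m) = (-1) ^ m * (x / 2) ^ m * ((-1) ^ j / (fact j * fact (m + j)) * ((x / 2)\<^sup>2) ^ j)" for j
  proof -
    have "rGamma (real_of_int (- int m + int (j + m) + 1)) = 1 / fact j"
      using Gamma_fact[of j, where ?'a = real] by (simp add: rGamma_inverse_Gamma divide_inverse add_ac)
    moreover have "(x / 2) powi (2 * int (j + m) + - int m) = (x / 2) ^ m * ((x / 2)\<^sup>2) ^ j"
    proof -
      have "2 * int (j + m) + - int m = int (m + 2 * j)" by simp
      thus ?thesis by (simp only: power_int_of_nat power_add power_mult)
    qed
    ultimately show ?thesis by (simp add: a_def power_add add_ac mult_ac)
  qed
  have "(\<lambda>j. a (j + m)) sums ((-1) ^ m * (x / 2) ^ m * bessel_g m ((x / 2)\<^sup>2))"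
    unfolding shift by (intro sums_mult bessel_g_sums)
  hence "a sums ((-1) ^ m * (x / 2) ^ m * bessel_g m ((x / 2)\<^sup>2))"
    by (subst (asm) sums_iff_shift) (simp add: zero)
  moreover have "bessel_J (- int m) x = suminf a"
    by (simp only: bessel_J_def a_def)
  ultimately show ?thesis
    by (simp add: sums_iff bessel_J_nat)
qed

lemma continuous_on_bessel_g [continuous_intros]:
  "continuous_on S f \<Longrightarrow> continuous_on S (\<lambda>x. bessel_g m (f x))"
  using DERIV_continuous_on[of UNIV "bessel_g m", OF bessel_g_deriv[THEN DERIV_subset]]
  by (rule continuous_on_compose2) auto

lemma continuous_on_bessel_J [continuous_intros]:
  assumes "continuous_on S f"
  shows "continuous_on S (\<lambda>x. bessel_J m (f x))"
proof -
  obtain n where "m = int n \<or> m = - int n" by (metis nonneg_int_cases nonpos_int_cases linear)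
  thus ?thesis
    by (elim disjE) (simp add: bessel_J_nat bessel_J_uminus assms continuous_intros)+
qed

text \<open>Together with \<open>bessel_J_Suc_scaled_deriv\<close> this is a closed first-order
  system for the pair J_m, J_(m+1). All later identities are verified from it, without Bessel's
  second-order equation.\<close>

lemma bessel_J_scaled_deriv:
  fixes a r :: real
  assumes "r > 0"
  shows "((\<lambda>r. bessel_J (int m) (a * r)) has_real_derivative
           (real m / r * bessel_J (int m) (a * r) - a * bessel_J (int (Suc m)) (a * r))) (at r)"
proof -
  have g: "((\<lambda>r. bessel_g m ((a * r / 2)\<^sup>2)) has_real_derivative
      - bessel_g (Suc m) ((a * r / 2)\<^sup>2) * (a\<^sup>2 * r / 2)) (at r)"
    by (rule DERIV_chain'[OF _ bessel_g_deriv])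
       (auto intro!: derivative_eq_intros simp: power2_eq_square)
  have p: "((\<lambda>r. (a * r / 2) ^ m) has_real_derivative (real m / r * (a * r / 2) ^ m)) (at r)"
  proof (cases m)
    case (Suc n)
    have "((\<lambda>r. (a * r / 2) ^ Suc n) has_real_derivative (1 + real n) * (a / 2 * (a * r / 2) ^ n)) (at r)"
      by (rule DERIV_power_Suc) (auto intro!: derivative_eq_intros)
    moreover have "(1 + real n) * (a / 2 * Z) = real (Suc n) / r * (a * r / 2 * Z)" for Z
      using assms by (simp add: field_simps)
    ultimately show ?thesis by (simp add: Suc)
  qed simp
  show ?thesis
    unfolding bessel_J_nat
    by (rule derivative_eq_intros p g refl)+ (simp add: field_simps power2_eq_square)
qed

lemma bessel_J_Suc_scaled_deriv:
  fixes a r :: real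
  assumes "r > 0"
  shows "((\<lambda>r. bessel_J (int (Suc m)) (a * r)) has_real_derivative
           (a * bessel_J (int m) (a * r) - (real m + 1) / r * bessel_J (int (Suc m)) (a * r))) (at r)"
proof -
  have "real (Suc m) / r * bessel_J (int (Suc m)) (a * r) - a * bessel_J (int (Suc (Suc m))) (a * r) =
      a * bessel_J (int m) (a * r) - (real m + 1) / r * bessel_J (int (Suc m)) (a * r)"
    unfolding bessel_J_nat bessel_g_rec[of m] using assms
    by (simp add: field_simps power2_eq_square)
  thus ?thesis using bessel_J_scaled_deriv[OF assms, of "Suc m" a] by simp
qed

lemmas bessel_J_deriv = bessel_J_scaled_deriv[where a = 1, unfolded mult_1]
lemmas bessel_J_Suc_deriv = bessel_J_Suc_scaled_deriv[where a = 1, unfolded mult_1]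

section \<open>Lommel's integrals, decay at infinity and oscillation\<close>

lemma bessel_J_pos_near_0:
  obtains e where "e > 0" "\<And>t. 0 < t \<Longrightarrow> t < e \<Longrightarrow> bessel_J (int m) t > 0"
proof -
  have "continuous_on UNIV (\<lambda>t. bessel_g m ((t / 2)\<^sup>2))"
    by (intro continuous_intros) auto
  hence "isCont (\<lambda>t. bessel_g m ((t / 2)\<^sup>2)) 0"
    by (simp add: continuous_on_eq_continuous_at)
  hence "((\<lambda>t. bessel_g m ((t / 2)\<^sup>2)) \<longlongrightarrow> bessel_g m ((0 / 2)\<^sup>2)) (at_right 0)"
    unfolding isCont_def filterlim_at_split by blast
  moreover have "bessel_g m 0 > 0"
    unfolding bessel_g_def powser_zero by simp
  ultimately have "eventually (\<lambda>t. bessel_g m ((t / 2)\<^sup>2) > 0) (at_right 0)"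
    by (intro order_tendstoD) auto
  then obtain e where "e > 0" "\<And>t. 0 < t \<Longrightarrow> t < e \<Longrightarrow> bessel_g m ((t / 2)\<^sup>2) > 0"
    unfolding eventually_at_right_field by auto
  thus thesis by (intro that[of e]) (auto simp: bessel_J_nat)
qed

text \<open>\<open>G\<close> is \<open>r\<close> times the Wronskian of J_m(zr) and J_m(ar), with
  derivatives expressed through J_(m+1); its derivative is (z^2 - a^2) times the integrand. At r = 1
  only the term without J_m(z) survives.\<close>

lemma lommel_integral_neq:
  assumes "bessel_J (int m) z = 0" "a\<^sup>2 \<noteq> z\<^sup>2"
  shows "((\<lambda>r. r * bessel_J (int m) (z * r) * bessel_J (int m) (a * r)) has_integral
      - z * bessel_J (int (Suc m)) z * (bessel_J (int m) a / (a\<^sup>2 - z\<^sup>2))) {0..1}"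
proof -
  let ?J = "bessel_J (int m)" and ?J1 = "bessel_J (int (Suc m))"
  define G where "G = (\<lambda>r. r * (z * ?J1 (z * r) * ?J (a * r) - a * ?J (z * r) * ?J1 (a * r)))"
  have "((\<lambda>r. (z\<^sup>2 - a\<^sup>2) * (r * ?J (z * r) * ?J (a * r))) has_integral G 1 - G 0) {0..1}"
  \<comment> \<open>The derivative formulas divide by \<open>r\<close>, so at 0 only continuity of
    \<open>G\<close> is used.\<close>
  proof (rule fundamental_theorem_of_calculus_interior)
    show "continuous_on {0..1} G"
      unfolding G_def by (intro continuous_intros)
    fix r :: real assume "r \<in> {0<..<1}"
    hence r: "r > 0" by simp
    have "(G has_real_derivative (z\<^sup>2 - a\<^sup>2) * (r * ?J (z * r) * ?J (a * r))) (at r)"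
      unfolding G_def
      by (rule derivative_eq_intros bessel_J_scaled_deriv[OF r, where m = m] bessel_J_Suc_scaled_deriv[OF r] refl)+
         (use r in \<open>simp add: field_simps power2_eq_square\<close>)
    thus "(G has_vector_derivative (z\<^sup>2 - a\<^sup>2) * (r * ?J (z * r) * ?J (a * r))) (at r)"
      by (simp add: has_real_derivative_iff_has_vector_derivative)
  qed simp
  hence "((\<lambda>r. inverse (z\<^sup>2 - a\<^sup>2) * ((z\<^sup>2 - a\<^sup>2) * (r * ?J (z * r) * ?J (a * r)))) has_integral
      inverse (z\<^sup>2 - a\<^sup>2) * (G 1 - G 0)) {0..1}"
    by (rule has_integral_mult_right)
  moreover have "inverse (z\<^sup>2 - a\<^sup>2) * (G 1 - G 0) = - z * ?J1 z * (?J a / (a\<^sup>2 - z\<^sup>2))"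
    using assms by (simp add: G_def divide_simps) (simp add: algebra_simps)
  ultimately show ?thesis using assms(2) by (simp flip: mult.assoc)
qed

text \<open>The case of equal parameters, with an explicit antiderivative \<open>G\<close>; since
  J_m(z) = 0, only the square of J_(m+1) remains at r = 1.\<close>

lemma lommel_integral_eq:
  assumes "bessel_J (int m) z = 0" "z \<noteq> 0"
  shows "((\<lambda>r. r * bessel_J (int m) (z * r) * bessel_J (int m) (z * r)) has_integral
      (bessel_J (int (Suc m)) z)\<^sup>2 / 2) {0..1}"
proof -
  let ?J = "bessel_J (int m)" and ?J1 = "bessel_J (int (Suc m))"
  define G where "G = (\<lambda>r. 1 / 2 * (r * r) * ((?J (z * r))\<^sup>2 + (?J1 (z * r))\<^sup>2) - real m / z * (r * ?J (z * r) * ?J1 (z * r)))"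
  have "((\<lambda>r. r * ?J (z * r) * ?J (z * r)) has_integral G 1 - G 0) {0..1}"
  proof (rule fundamental_theorem_of_calculus_interior)
    show "continuous_on {0..1} G"
      unfolding G_def by (intro continuous_intros)
    fix r :: real assume "r \<in> {0<..<1}"
    hence r: "r > 0" by simp
    have "(G has_real_derivative r * ?J (z * r) * ?J (z * r)) (at r)"
      unfolding G_def
      by (rule derivative_eq_intros bessel_J_scaled_deriv[OF r, where m = m] bessel_J_Suc_scaled_deriv[OF r] refl)+
         (use r assms(2) in \<open>simp add: field_simps power2_eq_square\<close>)
    thus "(G has_vector_derivative r * ?J (z * r) * ?J (z * r)) (at r)"
      by (simp add: has_real_derivative_iff_has_vector_derivative)
  qed simp
  thus ?thesis by (simp add: G_def assms)
qed

text \<open>This says that the zero is simple. Otherwise Lommel's integral of the nonnegative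
  function r J_m(zr)^2 would vanish, contradicting positivity of J_m near 0.\<close>

lemma bessel_J_Suc_nonzero_at_zero:
  assumes "bessel_J (int m) z = 0" "z > 0"
  shows "bessel_J (int (Suc m)) z \<noteq> 0"
proof
  assume 0: "bessel_J (int (Suc m)) z = 0"
  obtain e where e: "e > 0" "\<And>t. 0 < t \<Longrightarrow> t < e \<Longrightarrow> bessel_J (int m) t > 0"
    using bessel_J_pos_near_0 by blast
  define r where "r = min 1 (e / (2 * z))"
  have r: "0 < r" "r \<le> 1" using e assms by (auto simp: r_def)
  have zr: "z * r < e"
  proof -
    have "z * r \<le> z * (e / (2 * z))"
      unfolding r_def using assms(2) by (intro mult_left_mono) auto
    also have "\<dots> < e" using e assms(2) by simp
    finally show ?thesis .
  qed
  have "r * bessel_J (int m) (z * r) * bessel_J (int m) (z * r) = 0"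
  proof (rule has_integral_0_cbox_imp_0[where a = 0 and b = 1 and x = r
        and f = "\<lambda>r. r * bessel_J (int m) (z * r) * bessel_J (int m) (z * r)"])
    show "continuous_on (cbox 0 1) (\<lambda>r. r * bessel_J (int m) (z * r) * bessel_J (int m) (z * r))"
      by (intro continuous_intros)
    show "((\<lambda>r. r * bessel_J (int m) (z * r) * bessel_J (int m) (z * r)) has_integral 0) (cbox 0 1)"
      using lommel_integral_eq[OF assms(1)] assms(2) 0 by simp
  qed (use r in \<open>auto simp: mult.assoc\<close>)
  thus False using e(2)[of "z * r"] r zr assms(2) by simp
qed

text \<open>The cross term in the energy \<open>E\<close> cancels the part of \<open>(t (J\<^sub>m\<^sup>2 + J\<^sub>m\<^sub>+\<^sub>1\<^sup>2))'\<close> that is not integrable at infinity.\<close>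

lemma bessel_J_decay_nat:
  obtains C where "\<And>t. t > 0 \<Longrightarrow> \<bar>bessel_J (int m) t\<bar> * sqrt t \<le> C"
proof -
  let ?J = "bessel_J (int m)" and ?J1 = "bessel_J (int (Suc m))"
  \<comment> \<open>The system gives (t (J^2 + J1^2))' = v (J^2 - J1^2) and (J J1)' = J^2 - J1^2 - J
    J1 / t, so subtracting v J J1 in \<open>E\<close> leaves only v J J1 / t. Beyond
    \<open>T\<close> the cross term takes away at most half of the main term.\<close>
  define v where "v = real (2 * m + 1)"
  define T where "T = 2 * v"
  have v: "v \<ge> 1" and T: "T > 0" by (simp_all add: v_def T_def)
  define E where "E = (\<lambda>t. t * ((?J t)\<^sup>2 + (?J1 t)\<^sup>2) - v * ?J t * ?J1 t)"
  have E': "(E has_real_derivative v / t * ?J t * ?J1 t) (at t)" if "t > 0" for t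
    unfolding E_def
    by (rule derivative_eq_intros bessel_J_deriv[OF that, where m = m] bessel_J_Suc_deriv[OF that] refl)+
       (use that in \<open>simp add: field_simps power2_eq_square v_def\<close>)
  have prod: "2 * \<bar>?J t * ?J1 t\<bar> \<le> (?J t)\<^sup>2 + (?J1 t)\<^sup>2" for t
    using sum_squares_bound[of "\<bar>?J t\<bar>" "\<bar>?J1 t\<bar>"] by (simp add: abs_mult mult.assoc)
  have E_lower: "t / 2 * ((?J t)\<^sup>2 + (?J1 t)\<^sup>2) \<le> E t" if "t \<ge> T" for t
  proof -
    have "v * ?J t * ?J1 t \<le> v * \<bar>?J t * ?J1 t\<bar>"
      using v by (simp add: mult.assoc mult_left_mono)
    also have "\<dots> \<le> v * (((?J t)\<^sup>2 + (?J1 t)\<^sup>2) / 2)"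
      using v prod[of t] by (intro mult_left_mono) auto
    also have "\<dots> \<le> t / 2 * ((?J t)\<^sup>2 + (?J1 t)\<^sup>2)"
    proof -
      have "v * ((?J t)\<^sup>2 + (?J1 t)\<^sup>2) \<le> t * ((?J t)\<^sup>2 + (?J1 t)\<^sup>2)"
        using that v by (intro mult_right_mono) (auto simp: T_def)
      thus ?thesis by simp
    qed
    finally show ?thesis by (simp add: E_def algebra_simps)
  qed
  \<comment> \<open>Gronwall: E' <= (v / t^2) E, and v / t^2 is integrable at infinity with
    integrating factor \<open>exp (v / t)\<close>, so \<open>E\<close> stays bounded.\<close>
  have bound: "E t * exp (v / t) \<le> E T * exp (v / T)" if "t \<ge> T" for t
  proof (rule DERIV_nonpos_imp_nonincreasing[OF that])
    fix s assume s: "T \<le> s" "s \<le> t"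
    hence s0: "s > 0" using T by simp
    have q: "((\<lambda>t. v / t) has_real_derivative - (v / s\<^sup>2)) (at s)"
      using s0 by (auto intro!: derivative_eq_intros simp: power2_eq_square)
    have "((\<lambda>t. E t * exp (v / t)) has_real_derivative
        (v / s * ?J s * ?J1 s - v / s\<^sup>2 * E s) * exp (v / s)) (at s)"
      by (rule q derivative_eq_intros E'[OF s0] refl)+
         (use s0 in \<open>simp_all add: field_simps power2_eq_square\<close>)
    moreover have "v / s * ?J s * ?J1 s \<le> v / s\<^sup>2 * E s"
    proof -
      have "v / s * (?J s * ?J1 s) \<le> v / s * (((?J s)\<^sup>2 + (?J1 s)\<^sup>2) / 2)"
        using prod[of s] s0 v by (intro mult_left_mono) auto
      also have "\<dots> = v / s\<^sup>2 * (s / 2 * ((?J s)\<^sup>2 + (?J1 s)\<^sup>2))"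
        using s0 by (simp add: field_simps power2_eq_square)
      also have "\<dots> \<le> v / s\<^sup>2 * E s"
        using E_lower[OF s(1)] v by (intro mult_left_mono) auto
      finally show ?thesis by (simp add: mult.assoc)
    qed
    ultimately show "\<exists>y. ((\<lambda>t. E t * exp (v / t)) has_real_derivative y) (at s) \<and> y \<le> 0"
      by (intro exI conjI) (auto intro!: mult_nonpos_nonneg)
  qed
  define D where "D = 2 * (E T * exp (v / T))"
  have far: "\<bar>?J t\<bar> * sqrt t \<le> sqrt D" if t: "t \<ge> T" for t
  proof (rule real_le_rsqrt)
    have "(\<bar>?J t\<bar> * sqrt t)\<^sup>2 = t * (?J t)\<^sup>2"
      using t T by (simp add: power_mult_distrib)
    also have "\<dots> \<le> t * ((?J t)\<^sup>2 + (?J1 t)\<^sup>2)"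
      using t T by (intro mult_left_mono) auto
    also have "\<dots> \<le> 2 * E t" using E_lower[OF t] by simp
    also have "\<dots> \<le> 2 * (E t * exp (v / t))"
    proof -
      have "E t \<ge> 0" using order_trans[OF _ E_lower[OF t], of 0] t T by simp
      moreover have "exp (v / t) \<ge> 1" using t T v by simp
      ultimately have "E t * 1 \<le> E t * exp (v / t)" by (intro mult_left_mono)
      thus ?thesis by simp
    qed
    also have "\<dots> \<le> D" using bound[OF t] by (simp add: D_def)
    finally show "(\<bar>?J t\<bar> * sqrt t)\<^sup>2 \<le> D" .
  qed
  have "compact ((\<lambda>t. \<bar>?J t\<bar> * sqrt t) ` {0..T})"
    by (intro compact_continuous_image continuous_intros) auto
  then obtain C where C: "\<forall>y\<in>(\<lambda>t. \<bar>?J t\<bar> * sqrt t) ` {0..T}. norm y \<le> C"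
    using compact_imp_bounded bounded_iff by metis
  show thesis
  proof
    fix t :: real assume t: "t > 0"
    show "\<bar>?J t\<bar> * sqrt t \<le> max C (sqrt D)"
    proof (cases "t \<ge> T")
      case False
      hence "norm (\<bar>?J t\<bar> * sqrt t) \<le> C" using C t by auto
      thus ?thesis by simp
    qed (use far[of t] in auto)
  qed
qed

text \<open>Sturm comparison of \<open>\<surd>t J\<^sub>m(t)\<close> with \<open>sin((t - a)/2)\<close> on an interval of length \<open>2\<pi>\<close>; \<open>W\<close> is their Wronskian.\<close>

lemma bessel_J_unbounded_zeros:
  obtains t where "t > T" "bessel_J (int m) t = 0"
proof -
  \<comment> \<open>The factor \<open>sqrt t\<close> removes the first-order term: the system below
    amounts to p'' = (-1 + (v^2 - v) / t^2) p with v = m + 1/2.\<close>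
  define p where "p = (\<lambda>m t. sqrt t * bessel_J (int m) t)"
  define v where "v = real m + 1 / 2"
  have v: "v > 0" by (simp add: v_def)
  have p': "(p m has_real_derivative v / t * p m t - p (Suc m) t) (at t)"
       and p1': "(p (Suc m) has_real_derivative p m t - v / t * p (Suc m) t) (at t)" if t: "t > 0" for t
  proof -
    have s: "(sqrt has_real_derivative sqrt t / (2 * t)) (at t)"
    proof -
      have "inverse (sqrt t) / 2 = sqrt t / (2 * t)"
        using t by (simp add: divide_simps)
      thus ?thesis using DERIV_real_sqrt[OF t] by (simp add: mult.commute)
    qed
    show "(p m has_real_derivative v / t * p m t - p (Suc m) t) (at t)"
      unfolding p_def
      by (rule s derivative_eq_intros bessel_J_deriv[OF t, where m = m] refl)+
         (use t in \<open>simp add: v_def field_simps\<close>)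
    show "(p (Suc m) has_real_derivative p m t - v / t * p (Suc m) t) (at t)"
      unfolding p_def
      by (rule s derivative_eq_intros bessel_J_Suc_deriv[OF t, where m = m] refl)+
         (use t in \<open>simp add: v_def field_simps\<close>)
  qed
  show thesis
  proof (rule ccontr)
    assume "\<not> thesis"
    hence nz: "bessel_J (int m) t \<noteq> 0" if "t > T" for t using that \<open>\<And>t. T < t \<Longrightarrow> bessel_J (int m) t = 0 \<Longrightarrow> thesis\<close> by blast
    \<comment> \<open>From 2 v on, (v^2 - v) / t^2 <= 1/4, so p oscillates faster than the
      comparison sine of frequency 1/2, which is nonnegative on the interval and vanishes at both
      ends.\<close>
    define a where "a = max (T + 1) (2 * v)"
    have a: "a > T" "a \<ge> 2 * v" "a > 0" using v by (auto simp: a_def)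
    define b where "b = a + 2 * pi"
    have b: "a < b" by (simp add: b_def)
    have cont: "continuous_on {a..b} (p m)"
      unfolding p_def by (intro continuous_intros)
    have pnz: "p m t \<noteq> 0" if "t \<in> {a..b}" for t
      using nz[of t] that a by (simp add: p_def)
    have "\<exists>s::real. s \<noteq> 0 \<and> (\<forall>t\<in>{a..b}. s * p m t > 0)"
    proof (cases "p m a > 0")
      case True
      have "p m t > 0" if t: "t \<in> {a..b}" for t
      proof (rule ccontr)
        assume "\<not> p m t > 0"
        then obtain x where "a \<le> x" "x \<le> t" "p m x = 0"
          using IVT2'[of "p m" t 0 a] True t continuous_on_subset[OF cont] by force
        thus False using pnz[of x] t by auto
      qed
      thus ?thesis by (intro exI[of _ 1]) auto
    next
      case False
      hence neg: "p m a < 0" using pnz[of a] b by force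
      have "p m t < 0" if t: "t \<in> {a..b}" for t
      proof (rule ccontr)
        assume "\<not> p m t < 0"
        then obtain x where "a \<le> x" "x \<le> t" "p m x = 0"
          using IVT'[of "p m" a 0 t] neg t continuous_on_subset[OF cont] by force
        thus False using pnz[of x] t by auto
      qed
      thus ?thesis by (intro exI[of _ "-1"]) auto
    qed
    then obtain s where s: "\<And>t. t \<in> {a..b} \<Longrightarrow> s * p m t > 0" by blast
    define W where "W = (\<lambda>t. s * ((v / t * p m t - p (Suc m) t) * sin ((t - a) / 2) - p m t * (cos ((t - a) / 2) / 2)))"
    \<comment> \<open>\<open>s\<close> makes s p positive on the whole interval. Then W' <= 0, while
      W(a) = -s p(a) / 2 is negative and W(b) = s p(b) / 2 is positive.\<close>
    have "W b \<le> W a"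
    proof (rule DERIV_nonpos_imp_nonincreasing[OF less_imp_le[OF b]])
      fix t assume t: "a \<le> t" "t \<le> b"
      hence t0: "t > 0" using a by simp
      define q where "q = 1 / 4 - 1 + (v\<^sup>2 - v) / t\<^sup>2"
      have d: "((\<lambda>t. v / t) has_real_derivative - (v / t\<^sup>2)) (at t)"
        using t0 by (auto intro!: derivative_eq_intros simp: power2_eq_square)
      have sn: "((\<lambda>t. sin ((t - a) / 2)) has_real_derivative cos ((t - a) / 2) / 2) (at t)"
       and cs: "((\<lambda>t. cos ((t - a) / 2) / 2) has_real_derivative - (sin ((t - a) / 2) / 4)) (at t)"
        by (auto intro!: derivative_eq_intros)
      have "(W has_real_derivative q * (s * p m t) * sin ((t - a) / 2)) (at t)"
        unfolding W_def
        by (rule d sn cs derivative_eq_intros p'[OF t0] p1'[OF t0] refl)+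
           (use t0 in \<open>simp_all add: q_def field_simps power2_eq_square\<close>)
      moreover have "q \<le> 0"
      proof -
        have "v\<^sup>2 - v \<le> (t / 2)\<^sup>2"
        proof -
          have "v\<^sup>2 \<le> (t / 2)\<^sup>2" using v a t by (intro power_mono) auto
          thus ?thesis using v by linarith
        qed
        hence "(v\<^sup>2 - v) / t\<^sup>2 \<le> 1 / 4"
          using t0 by (simp add: power_divide divide_simps)
        thus ?thesis by (simp add: q_def)
      qed
      moreover have "sin ((t - a) / 2) \<ge> 0"
        using t by (intro sin_ge_zero) (auto simp: b_def)
      ultimately show "\<exists>y. (W has_real_derivative y) (at t) \<and> y \<le> 0"
        using s[of t] t by (meson atLeastAtMost_iff less_imp_le mult_nonpos_nonneg)
    qed
    moreover have "W a = - (s * p m a) / 2" "W b = s * p m b / 2"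
      by (simp_all add: W_def b_def)
    ultimately show False using s[of a] s[of b] b by simp
  qed
qed

section \<open>The recursively defined zeros and the sign of the next Bessel function there\<close>

lemma continuous_sign_constant:
  fixes g :: "real \<Rightarrow> real"
  assumes "continuous_on {a<..<b} g" "\<And>t. t \<in> {a<..<b} \<Longrightarrow> g t \<noteq> 0"
    and "s \<in> {a<..<b}" "g s > 0" "t \<in> {a<..<b}"
  shows "g t > 0"
proof (rule ccontr)
  assume "\<not> g t > 0"
  have sub: "{min s t..max s t} \<subseteq> {a<..<b}" using assms(3,5) by auto
  have "connected (g ` {min s t..max s t})"
    by (intro connected_continuous_image continuous_on_subset[OF assms(1) sub]) auto
  hence "0 \<in> g ` {min s t..max s t}"
    using \<open>\<not> g t > 0\<close> assms(4) connected_contains_Icc[of "g ` {min s t..max s t}" "g t" "g s"] by force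
  thus False using assms(2) sub by auto
qed

text \<open>The last clause is the invariant that isolates the infimum defining the next zero.\<close>

lemma bessel_zero_step:
  assumes "bessel_zero (int m) n \<ge> 0"
    and e: "e > 0" "\<And>t. bessel_zero (int m) n < t \<Longrightarrow> t < bessel_zero (int m) n + e \<Longrightarrow> (-1) ^ n * bessel_J (int m) t > 0"
  shows "bessel_zero (int m) (Suc n) > bessel_zero (int m) n"
    and "bessel_J (int m) (bessel_zero (int m) (Suc n)) = 0"
    and "(-1) ^ n * bessel_J (int (Suc m)) (bessel_zero (int m) (Suc n)) > 0"
    and "\<exists>e>0. \<forall>t. bessel_zero (int m) (Suc n) < t \<longrightarrow> t < bessel_zero (int m) (Suc n) + e \<longrightarrow>
           (-1) ^ Suc n * bessel_J (int m) t > 0"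
proof -
  let ?J = "bessel_J (int m)"
  define z where "z = bessel_zero (int m) n"
  define S where "S = {t. z < t \<and> ?J t = 0}"
  define y where "y = bessel_zero (int m) (Suc n)"
  have y_Inf: "y = Inf S" by (simp add: y_def S_def z_def)
  \<comment> \<open>The strict inequality in \<open>S\<close> becomes a non-strict one with gap
    \<open>e\<close>, so \<open>S\<close> is closed and its infimum is attained.\<close>
  have S_eq: "S = {z + e..} \<inter> ?J -` {0}"
  proof -
    have "t \<ge> z + e" if "t \<in> S" for t
      using e(2)[of t] that by (force simp: S_def z_def)
    thus ?thesis using e(1) by (auto simp: S_def)
  qed
  have "closed S"
    unfolding S_eq by (intro continuous_closed_preimage continuous_intros)
  moreover have "S \<noteq> {}"
    using bessel_J_unbounded_zeros[of z m] by (auto simp: S_def)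
  moreover have bdd: "bdd_below S" by (rule bdd_belowI[of _ z]) (auto simp: S_def)
  ultimately have "y \<in> S" unfolding y_Inf by (intro closed_contains_Inf)
  thus y: "y > z" and Jy: "?J y = 0" by (auto simp: S_def)
  have y0: "y > 0" using y assms(1) by (simp add: z_def)
  define g where "g = (\<lambda>t. (-1) ^ n * ?J t)"
  have gpos: "g t > 0" if t: "t \<in> {z<..<y}" for t
  proof (rule continuous_sign_constant[where g = g and a = z and b = y and t = t and s = "min (z + e / 2) ((z + y) / 2)"])
    show "continuous_on {z<..<y} g" unfolding g_def by (intro continuous_intros)
    show "g t \<noteq> 0" if "t \<in> {z<..<y}" for t
      using cInf_lower[OF _ bdd, of t] that by (auto simp: g_def S_def y_Inf)
    show "0 < g (min (z + e / 2) ((z + y) / 2))"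
      unfolding g_def z_def by (rule e(2)) (use e(1) y in \<open>auto simp: z_def min_def\<close>)
  qed (use t e(1) y in \<open>auto simp: min_def\<close>)
  have g': "(g has_real_derivative (- ((-1) ^ n * bessel_J (int (Suc m)) y))) (at y)"
    unfolding g_def using DERIV_cmult[OF bessel_J_deriv[OF y0, where m = m], of "(-1) ^ n"] Jy by simp
  have nz: "(-1) ^ n * bessel_J (int (Suc m)) y \<noteq> 0"
    using bessel_J_Suc_nonzero_at_zero[OF Jy y0] by simp
  have gy: "g y = 0" by (simp add: g_def Jy)
  \<comment> \<open>\<open>g\<close> is positive to the left of its zero \<open>y\<close>, so its
    derivative there, minus this quantity, cannot be positive; by simplicity of the zero it is not 0
    either.\<close>
  show *: "(-1) ^ n * bessel_J (int (Suc m)) y > 0"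
  proof (rule ccontr)
    assume "\<not> ?thesis"
    hence "- ((-1) ^ n * bessel_J (int (Suc m)) y) > 0"
      using nz by (meson linorder_neqE_linordered_idom neg_0_less_iff_less)
    from DERIV_pos_inc_left[OF g' this] obtain d where
      d: "d > 0" "\<forall>h>0. h < d \<longrightarrow> g (y - h) < g y" by blast
    define h where "h = min (d / 2) ((y - z) / 2)"
    have "h > 0" "h < d" "y - h \<in> {z<..<y}" using d(1) y by (auto simp: h_def min_def field_simps)
    thus False using d(2) gpos[of "y - h"] gy by force
  qed
  hence "- ((-1) ^ n * bessel_J (int (Suc m)) y) < 0" by simp
  from DERIV_neg_dec_right[OF g' this] obtain d where
    d: "d > 0" "\<forall>h>0. h < d \<longrightarrow> g (y + h) < g y" by blast
  have "(-1) ^ Suc n * ?J t > 0" if "y < t" "t < y + d" for t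
    using d(2)[rule_format, of "t - y"] that gy by (simp add: g_def)
  thus "\<exists>e>0. \<forall>t. y < t \<longrightarrow> t < y + e \<longrightarrow> (-1) ^ Suc n * ?J t > 0"
    using d(1) by blast
qed

lemma bessel_zero_invariant:
  "bessel_zero (int m) n \<ge> 0 \<and> (\<exists>e>0. \<forall>t. bessel_zero (int m) n < t \<longrightarrow> t < bessel_zero (int m) n + e \<longrightarrow>
     (-1) ^ n * bessel_J (int m) t > 0)"
proof (induction n)
  case 0
  show ?case using bessel_J_pos_near_0[of m] by (metis bessel_zero.simps(1) add_0 mult_1 order_refl power_0)
next
  case (Suc n)
  then obtain e where "bessel_zero (int m) n \<ge> 0" "e > 0"
    "\<And>t. bessel_zero (int m) n < t \<Longrightarrow> t < bessel_zero (int m) n + e \<Longrightarrow> (-1) ^ n * bessel_J (int m) t > 0"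
    by blast
  from bessel_zero_step(1,4)[OF this] this(1) show ?case by (meson less_imp_le order_trans)
qed

text \<open>The third clause later replaces the absolute value in the normalisation of
  \<open>Psi\<close> by the sign (-1)^n of \<open>c_coeff\<close>. The step from index n - 1
  accounts for the change from > to <.\<close>

lemma bessel_zero_nat:
  assumes "n \<ge> 1"
  shows "bessel_zero (int m) n > 0"
    and "bessel_J (int m) (bessel_zero (int m) n) = 0"
    and "(-1) ^ n * bessel_J (int (Suc m)) (bessel_zero (int m) n) < 0"
proof -
  obtain k where n: "n = Suc k" using assms by (cases n) auto
  obtain e where e: "bessel_zero (int m) k \<ge> 0" "e > 0"
    "\<And>t. bessel_zero (int m) k < t \<Longrightarrow> t < bessel_zero (int m) k + e \<Longrightarrow> (-1) ^ k * bessel_J (int m) t > 0"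
    using bessel_zero_invariant[of m k] by blast
  note * = bessel_zero_step[OF e]
  show "bessel_zero (int m) n > 0" using *(1) e(1) unfolding n by (rule order.strict_trans1[rotated])
  show "bessel_J (int m) (bessel_zero (int m) n) = 0" using *(2) unfolding n .
  show "(-1) ^ n * bessel_J (int (Suc m)) (bessel_zero (int m) n) < 0"
    using *(3) unfolding n power_Suc by simp
qed

lemma bessel_zero_uminus: "bessel_zero (- int m) n = bessel_zero (int m) n"
  by (induction n) (simp_all add: bessel_J_uminus)

section \<open>The Jacobi-Anger integral\<close>

lemma has_integral_cis_2pi:
  fixes k :: int
  shows "((\<lambda>x. cis (of_int k * x)) has_integral (if k = 0 then of_real (2 * pi) else 0)) {0..2 * pi}"
proof (cases "k = 0")
  case True
  thus ?thesis
    using has_integral_const_real[of "1::complex" 0 "2 * pi"] by (simp add: scaleR_conv_of_real)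
next
  case False
  have i: "- (\<i> * (z * \<i>)) = z" for z
    by (simp add: mult.commute[of z] flip: mult.assoc)
  have "((\<lambda>x. cis (of_int k * x)) has_integral
      cis (of_int k * (2 * pi)) / (\<i> * of_real (of_int k)) - cis (of_int k * 0) / (\<i> * of_real (of_int k))) {0..2 * pi}"
    using False
    by (intro fundamental_theorem_of_calculus)
       (auto simp: cis_conv_exp i intro!: derivative_eq_intros has_vector_derivative_real_field)
  moreover have "cis (of_int k * (2 * pi)) = 1"
    using cis_multiple_2pi[of "of_int k"] by (simp add: mult_ac)
  ultimately show ?thesis using False by simp
qed

text \<open>In the binomial expansion the \<open>l\<close>-th term has frequency e (2l - p - m), so
  integration over a period keeps only 2l = p + m.\<close>

lemma angular_integral_power:
  fixes w w' :: complex and e :: int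
  assumes e: "e \<noteq> 0"
  defines "X \<equiv> \<lambda>\<theta>. w * cis (of_int e * \<theta>)" and "Y \<equiv> \<lambda>\<theta>. w' * cis (- (of_int e * \<theta>))"
  shows "((\<lambda>\<theta>. (X \<theta> + Y \<theta>) ^ p / fact p * cis (- (real m * of_int e * \<theta>))) has_integral
     (\<Sum>l\<le>p. of_nat (p choose l) * w ^ l * w' ^ (p - l) / fact p * (if 2 * l = p + m then of_real (2 * pi) else 0))) {0..2 * pi}"
proof -
  have "((\<lambda>\<theta>. \<Sum>l\<le>p. of_nat (p choose l) * w ^ l * w' ^ (p - l) / fact p * cis (of_int (e * (2 * int l - int p - int m)) * \<theta>))
      has_integral (\<Sum>l\<le>p. of_nat (p choose l) * w ^ l * w' ^ (p - l) / fact p *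
        (if e * (2 * int l - int p - int m) = 0 then of_real (2 * pi) else 0))) {0..2 * pi}"
    by (intro has_integral_sum has_integral_mult_right has_integral_cis_2pi) auto
  moreover have "e * (2 * int l - int p - int m) = 0 \<longleftrightarrow> 2 * l = p + m" for l
    using e by auto
  moreover have "(\<Sum>l\<le>p. of_nat (p choose l) * w ^ l * w' ^ (p - l) / fact p * cis (of_int (e * (2 * int l - int p - int m)) * \<theta>)) =
      (X \<theta> + Y \<theta>) ^ p / fact p * cis (- (real m * of_int e * \<theta>))" for \<theta>
  proof -
    have "X \<theta> ^ l * Y \<theta> ^ (p - l) * cis (- (real m * of_int e * \<theta>)) =
        w ^ l * w' ^ (p - l) * cis (of_int (e * (2 * int l - int p - int m)) * \<theta>)" if "l \<le> p" for l
    proof -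
      have "cis (real l * (of_int e * \<theta>)) * cis (real (p - l) * - (of_int e * \<theta>)) * cis (- (real m * of_int e * \<theta>)) =
          cis (of_int (e * (2 * int l - int p - int m)) * \<theta>)"
        using that by (simp add: cis_mult of_nat_diff algebra_simps)
      thus ?thesis
        by (simp add: X_def Y_def power_mult_distrib Complex.DeMoivre mult_ac)
    qed
    hence h: "of_nat (p choose l) * w ^ l * w' ^ (p - l) / fact p * cis (of_int (e * (2 * int l - int p - int m)) * \<theta>) =
       of_nat (p choose l) * X \<theta> ^ l * Y \<theta> ^ (p - l) / fact p * cis (- (real m * of_int e * \<theta>))" if "l \<le> p" for l
      using that by (simp add: mult.assoc)
    thus ?thesis
      unfolding binomial_ring sum_divide_distrib sum_distrib_right
      by (intro sum.cong refl h) simp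
  qed
  ultimately show ?thesis by (simp only:)
qed

text \<open>The exponential series is integrated term by term, with majorant given by R = |w| +
  |w'|. Only the powers p = m + 2j contribute, and the binomial coefficient over p! leaves 1 / (j!
  (m+j)!).\<close>

lemma angular_integral_series:
  fixes w w' :: complex and e :: int
  assumes e: "e \<noteq> 0"
  obtains I where "((\<lambda>\<theta>. exp (w * cis (of_int e * \<theta>) + w' * cis (- (of_int e * \<theta>))) * cis (- (real m * of_int e * \<theta>))) has_integral I) {0..2 * pi}"
    and "(\<lambda>j. of_real (2 * pi) * (w ^ (m + j) * w' ^ j / (fact j * fact (m + j)))) sums I"
proof -
  define Z where "Z = (\<lambda>\<theta>. w * cis (of_int e * \<theta>) + w' * cis (- (of_int e * \<theta>)))"
  define u where "u = (\<lambda>\<theta>. cis (- (real m * of_int e * \<theta>)))"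
  define R where "R = cmod w + cmod w'"
  define t where "t = (\<lambda>p. \<Sum>l\<le>p. of_nat (p choose l) * w ^ l * w' ^ (p - l) / fact p *
      (if 2 * l = p + m then complex_of_real (2 * pi) else 0))"
  have "uniform_limit {0..2 * pi} (\<lambda>n \<theta>. \<Sum>p<n. Z \<theta> ^ p / fact p * u \<theta>) (\<lambda>\<theta>. \<Sum>p. Z \<theta> ^ p / fact p * u \<theta>) sequentially"
  proof (rule Weierstrass_m_test)
    show "summable (\<lambda>p. inverse (fact p) * R ^ p)" by (rule summable_exp)
    fix p \<theta>
    have "cmod (Z \<theta>) \<le> R"
      unfolding Z_def R_def by (rule norm_triangle_le) (simp add: norm_mult)
    hence "cmod (Z \<theta>) ^ p \<le> R ^ p" by (intro power_mono) auto
    thus "cmod (Z \<theta> ^ p / fact p * u \<theta>) \<le> inverse (fact p) * R ^ p"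
      by (simp add: u_def norm_mult norm_divide norm_power norm_inverse norm_fact divide_inverse mult.commute mult_right_mono)
  qed
  moreover have "(\<Sum>p. Z \<theta> ^ p / fact p * u \<theta>) = exp (Z \<theta>) * u \<theta>" for \<theta>
  proof -
    have "(\<lambda>p. Z \<theta> ^ p / fact p * u \<theta>) sums (exp (Z \<theta>) * u \<theta>)"
      using sums_mult2[OF exp_converges[of "Z \<theta>"], of "u \<theta>"] by (simp add: scaleR_conv_of_real divide_inverse mult_ac)
    thus ?thesis by (simp add: sums_iff)
  qed
  ultimately have lim: "uniform_limit {0..2 * pi} (\<lambda>n \<theta>. \<Sum>p<n. Z \<theta> ^ p / fact p * u \<theta>) (\<lambda>\<theta>. exp (Z \<theta>) * u \<theta>) sequentially"
    by simp
  have c: "continuous_on {0..2 * pi} (\<lambda>\<theta>. \<Sum>p<n. Z \<theta> ^ p / fact p * u \<theta>)" for n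
    unfolding Z_def u_def by (intro continuous_intros) auto
  obtain I J where IJ: "\<And>n. ((\<lambda>\<theta>. \<Sum>p<n. Z \<theta> ^ p / fact p * u \<theta>) has_integral I n) {0..2 * pi}"
      "((\<lambda>\<theta>. exp (Z \<theta>) * u \<theta>) has_integral J) {0..2 * pi}" "I \<longlonglongrightarrow> J"
    using uniform_limit_integral[OF lim c trivial_limit_sequentially] by blast
  have "((\<lambda>\<theta>. \<Sum>p<n. Z \<theta> ^ p / fact p * u \<theta>) has_integral (\<Sum>p<n. t p)) {0..2 * pi}" for n
    unfolding Z_def u_def t_def by (intro has_integral_sum angular_integral_power[OF e]) auto
  hence "I n = (\<Sum>p<n. t p)" for n
    using IJ(1) has_integral_unique by blast
  hence "I = (\<lambda>n. \<Sum>p<n. t p)" by (rule ext)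
  hence "t sums J" using IJ(3) by (simp only: sums_def)
  moreover have "(\<lambda>j. t (m + 2 * j)) sums J \<longleftrightarrow> t sums J"
  proof (rule sums_mono_reindex)
    show "strict_mono (\<lambda>j. m + 2 * j)" by (auto simp: strict_mono_def)
    fix p assume p: "p \<notin> range (\<lambda>j. m + 2 * j)"
    have "\<not> 2 * l = p + m" if "l \<le> p" for l
    proof
      assume "2 * l = p + m"
      hence "p = m + 2 * (l - m)" using that by linarith
      thus False using p by blast
    qed
    thus "t p = 0" by (simp add: t_def)
  qed
  ultimately have "(\<lambda>j. t (m + 2 * j)) sums J" by simp
  moreover have "t (m + 2 * j) = of_real (2 * pi) * (w ^ (m + j) * w' ^ j / (fact j * fact (m + j)))" for j
  proof -
    have "2 * l = m + 2 * j + m \<longleftrightarrow> l = m + j" for l by auto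
    hence "t (m + 2 * j) = of_nat ((m + 2 * j) choose (m + j)) * w ^ (m + j) * w' ^ j / fact (m + 2 * j) * of_real (2 * pi)"
      by (simp add: t_def sum.delta if_distrib[of "\<lambda>x. _ * x"] cong: if_cong)
    also have "(of_nat ((m + 2 * j) choose (m + j)) :: complex) = fact (m + 2 * j) / (fact (m + j) * fact j)"
      by (subst binomial_fact) auto
    finally show ?thesis by (simp add: mult_ac)
  qed
  ultimately have "(\<lambda>j. of_real (2 * pi) * (w ^ (m + j) * w' ^ j / (fact j * fact (m + j)))) sums J"
    by (simp only:)
  with IJ(2) show thesis unfolding Z_def u_def by (intro that)
qed

text \<open>With these \<open>w\<close>, \<open>w'\<close> the exponent is i s cos(theta - phi). The
  product w w' = -(s/2)^2 creates the alternating signs of the Bessel series, and the surplus w^m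
  creates i^m, the phase and (s/2)^m. The choice e = -1 serves the negative orders.\<close>

lemma angular_integral_bessel_nat:
  assumes e: "e = 1 \<or> e = (-1 :: int)"
  shows "((\<lambda>\<theta>. cis (s * cos (\<theta> - \<phi>)) * cis (- (real m * of_int e * \<theta>))) has_integral
     of_real (2 * pi) * \<i> ^ m * cis (- (real m * of_int e * \<phi>)) * of_real (bessel_J (int m) s)) {0..2 * pi}"
proof -
  define w where "w = \<i> * of_real (s / 2) * cis (- (of_int e * \<phi>))"
  define w' where "w' = \<i> * of_real (s / 2) * cis (of_int e * \<phi>)"
  obtain I where I: "((\<lambda>\<theta>. exp (w * cis (of_int e * \<theta>) + w' * cis (- (of_int e * \<theta>))) * cis (- (real m * of_int e * \<theta>))) has_integral I) {0..2 * pi}"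
    "(\<lambda>j. of_real (2 * pi) * (w ^ (m + j) * w' ^ j / (fact j * fact (m + j)))) sums I"
    by (rule angular_integral_series[of e]) (use e in auto)
  have "exp (w * cis (of_int e * \<theta>) + w' * cis (- (of_int e * \<theta>))) = cis (s * cos (\<theta> - \<phi>))" for \<theta>
  proof -
    have "w * cis (of_int e * \<theta>) + w' * cis (- (of_int e * \<theta>)) =
        \<i> * of_real (s / 2) * (cis (of_int e * (\<theta> - \<phi>)) + cis (- (of_int e * (\<theta> - \<phi>))))"
      by (simp add: w_def w'_def cis_mult algebra_simps)
    also have "cis (of_int e * (\<theta> - \<phi>)) + cis (- (of_int e * (\<theta> - \<phi>))) = of_real (2 * cos (\<theta> - \<phi>))"
      using e cos_minus[of "\<theta> - \<phi>"] by (auto simp: complex_eq_iff)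
    finally show ?thesis by (simp add: cis_conv_exp)
  qed
  moreover have "I = of_real (2 * pi) * \<i> ^ m * cis (- (real m * of_int e * \<phi>)) * of_real (bessel_J (int m) s)"
  proof -
    have "w ^ (m + j) * w' ^ j = \<i> ^ m * cis (- (real m * of_int e * \<phi>)) * of_real ((s / 2) ^ m * ((-1) ^ j * ((s / 2)\<^sup>2) ^ j))" for j
    proof -
      have "w * w' = of_real (- ((s / 2)\<^sup>2))"
      proof -
        have "w * w' = (\<i> * \<i>) * (of_real (s / 2) * of_real (s / 2)) * (cis (- (of_int e * \<phi>)) * cis (of_int e * \<phi>))"
          by (simp only: w_def w'_def mult_ac)
        thus ?thesis by (simp add: cis_mult power2_eq_square)
      qed
      hence "w ^ (m + j) * w' ^ j = w ^ m * of_real ((- ((s / 2)\<^sup>2)) ^ j)"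
        by (simp add: power_add flip: power_mult_distrib)
      also have "w ^ m = \<i> ^ m * of_real ((s / 2) ^ m) * cis (- (real m * of_int e * \<phi>))"
        unfolding w_def power_mult_distrib Complex.DeMoivre by (simp add: mult_ac)
      finally show ?thesis by (subst (asm) power_minus) (simp add: mult_ac)
    qed
    hence *: "(\<lambda>j. of_real (2 * pi) * (w ^ (m + j) * w' ^ j / (fact j * fact (m + j)))) =
       (\<lambda>j. of_real (2 * pi) * \<i> ^ m * cis (- (real m * of_int e * \<phi>)) *
          of_real ((s / 2) ^ m * ((-1) ^ j / (fact j * fact (m + j)) * ((s / 2)\<^sup>2) ^ j)))"
      by (simp add: mult_ac)
    have "(\<lambda>j. of_real (2 * pi) * \<i> ^ m * cis (- (real m * of_int e * \<phi>)) *
          of_real ((s / 2) ^ m * ((-1) ^ j / (fact j * fact (m + j)) * ((s / 2)\<^sup>2) ^ j))) sums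
        (of_real (2 * pi) * \<i> ^ m * cis (- (real m * of_int e * \<phi>)) * of_real (bessel_J (int m) s))"
      unfolding bessel_J_nat by (intro sums_mult sums_of_real bessel_g_sums)
    thus ?thesis unfolding *[symmetric] by (rule sums_unique2[OF I(2)])
  qed
  ultimately show ?thesis using I(1) by simp
qed

lemma angular_integral_bessel:
  "((\<lambda>\<theta>. cis (s * cos (\<theta> - \<phi>)) * cis (- (of_int m * \<theta>))) has_integral
     of_real (2 * pi) * \<i> powi m * cis (- (of_int m * \<phi>)) * of_real (bessel_J m s)) {0..2 * pi}"
proof (cases "m \<ge> 0")
  case True
  then obtain n where "m = int n" using nonneg_int_cases by blast
  thus ?thesis using angular_integral_bessel_nat[of 1 s \<phi> n] by simp
next
  case False
  then obtain n where m: "m = - int n" by (metis linear nonpos_int_cases)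
  \<comment> \<open>For negative order the sign (-1)^n of the Bessel function is absorbed by the
    power of i, so one formula covers all orders.\<close>
  have "\<i> powi (- int n) * of_real ((-1) ^ n) = \<i> ^ n"
    by (simp add: power_int_minus flip: power_inverse power_mult_distrib)
  hence *: "of_real (2 * pi) * \<i> ^ n * cis (real n * \<phi>) * of_real (bessel_J (int n) s) =
     of_real (2 * pi) * \<i> powi m * cis (- (of_int m * \<phi>)) * of_real (bessel_J m s)"
    by (simp add: m bessel_J_uminus mult_ac)
  have "((\<lambda>\<theta>. cis (s * cos (\<theta> - \<phi>)) * cis (- (of_int m * \<theta>))) has_integral
     of_real (2 * pi) * \<i> ^ n * cis (real n * \<phi>) * of_real (bessel_J (int n) s)) {0..2 * pi}"
    using angular_integral_bessel_nat[of "-1" s \<phi> n] by (simp add: m)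
  thus ?thesis by (simp only: *)
qed

section \<open>Fourier-Bessel coefficients of the modes\<close>

text \<open>Reduction to the order |m|: both J_m and, at the zero, J_(m+1) are \<open>eps m\<close>
  times the functions of order |m| and |m| + 1. In Lommel's integral the two signs cancel.\<close>

lemma bessel_zero_eps:
  assumes "n \<ge> 1"
  shows "bessel_zero m n > 0"
    and "bessel_J m (bessel_zero m n) = 0"
    and "bessel_J (m + 1) (bessel_zero m n) \<noteq> 0"
    and "bessel_J (m + 1) (bessel_zero m n) = - (eps m * (-1) ^ n * \<bar>bessel_J (m + 1) (bessel_zero m n)\<bar>)"
    and "t \<ge> 0 \<Longrightarrow> ((\<lambda>r. r * bessel_J m (bessel_zero m n * r) * bessel_J m (t * r)) has_integral
           - (bessel_zero m n * bessel_J (m + 1) (bessel_zero m n) * bessel_quotient m n t)) {0..1}"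
proof -
  define p where "p = nat \<bar>m\<bar>"
  define z where "z = bessel_zero m n"
  define s :: real where "s = eps m"
  have m: "m = int p \<and> m \<ge> 0 \<or> m = - int p \<and> m < 0 \<and> p \<ge> 1" by (auto simp: p_def)
  have inv: "inverse ((-1) ^ p) = ((-1) ^ p :: real)"
    by (simp flip: power_inverse)
  hence "s = 1 \<or> s = (-1) ^ p"
    using m by (auto simp: s_def eps_def power_int_minus)
  hence s: "s = 1 \<or> s = -1" by (cases "even p") auto
  hence ss: "s * (s * y) = y" for y by auto
  have J: "bessel_J m = (\<lambda>x. s * bessel_J (int p) x)"
    using m by (auto simp: s_def eps_def bessel_J_uminus fun_eq_iff power_int_minus inv)
  have z: "z = bessel_zero (int p) n"
    using m by (auto simp: z_def bessel_zero_uminus)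
  note zp = bessel_zero_nat[OF assms, of p, folded z]
  have J1: "bessel_J (m + 1) z = s * bessel_J (int (Suc p)) z"
  proof (cases "m \<ge> 0")
    case True
    thus ?thesis using m by (auto simp: s_def eps_def add.commute)
  next
    case False
    then obtain q where p: "p = Suc q" and mq: "m + 1 = - int q" using m by (cases p) auto
    \<comment> \<open>For m < 0 the order m + 1 has absolute value p - 1 rather than p + 1. Equating
      the two expressions for the derivative of J_p at its zero gives J_(p-1) = -J_(p+1)
      there.\<close>
    have "real p / z * bessel_J (int p) z - bessel_J (int (Suc p)) z = bessel_J (int q) z - (real q + 1) / z * bessel_J (int p) z"
      using DERIV_unique[OF bessel_J_deriv[OF zp(1), where m = p]] bessel_J_Suc_deriv[OF zp(1), where m = q]
      unfolding p by blast
    hence "bessel_J (int q) z = - bessel_J (int (Suc p)) z" using zp(2) by simp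
    moreover have "s = (-1) ^ p" using False m inv by (auto simp: s_def eps_def power_int_minus)
    ultimately show ?thesis unfolding mq bessel_J_uminus by (simp add: p)
  qed
  show "bessel_zero m n > 0" using zp(1) by (simp add: z_def)
  show "bessel_J m (bessel_zero m n) = 0" using zp(2) by (simp add: J z_def)
  have nz: "bessel_J (int (Suc p)) z \<noteq> 0" using zp(3) by auto
  thus "bessel_J (m + 1) (bessel_zero m n) \<noteq> 0" using s J1 by (auto simp: z_def)
  have "bessel_J (int (Suc p)) z = - ((-1) ^ n * \<bar>bessel_J (int (Suc p)) z\<bar>)"
    using zp(3) by (cases "even n") auto
  hence "bessel_J (m + 1) z = - (s * (-1) ^ n * \<bar>bessel_J (m + 1) z\<bar>)"
    unfolding J1 using s by (auto simp: abs_mult)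
  thus "bessel_J (m + 1) (bessel_zero m n) = - (eps m * (-1) ^ n * \<bar>bessel_J (m + 1) (bessel_zero m n)\<bar>)"
    by (simp only: z_def s_def)
  assume t: "t \<ge> 0"
  have "((\<lambda>r. r * bessel_J m (z * r) * bessel_J m (t * r)) has_integral
           - (z * bessel_J (m + 1) z * bessel_quotient m n t)) {0..1}"
  proof (cases "t = z")
    case True
    have "(bessel_J (int p) has_real_derivative - bessel_J (int (Suc p)) z) (at z)"
      using bessel_J_deriv[OF zp(1), where m = p] zp(2) by simp
    hence "deriv (bessel_J m) z = - s * bessel_J (int (Suc p)) z"
      unfolding J by (intro DERIV_imp_deriv) (auto intro!: derivative_eq_intros)
    hence "bessel_quotient m n t = - s * bessel_J (int (Suc p)) z / (2 * z)"
      using True by (simp add: bessel_quotient_def z_def)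
    thus ?thesis
      using lommel_integral_eq[OF zp(2)] zp(1) by (simp add: ss J J1 True power2_eq_square mult_ac)
  next
    case False
    hence "t\<^sup>2 \<noteq> z\<^sup>2" using t zp(1) by (simp add: power2_eq_iff)
    moreover have "bessel_quotient m n t = s * (bessel_J (int p) t / (t\<^sup>2 - z\<^sup>2))"
      using False by (simp add: bessel_quotient_def J z_def)
    ultimately show ?thesis
      using lommel_integral_neq[OF zp(2), of t] by (simp add: ss J J1 mult_ac)
  qed
  thus "((\<lambda>r. r * bessel_J m (bessel_zero m n * r) * bessel_J m (t * r)) has_integral
           - (bessel_zero m n * bessel_J (m + 1) (bessel_zero m n) * bessel_quotient m n t)) {0..1}"
    by (simp only: z_def)
qed

definition Psi_norm :: "int \<Rightarrow> nat \<Rightarrow> real" where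
  "Psi_norm m n = sqrt pi * \<bar>bessel_J (m + 1) (bessel_zero m n)\<bar>"

lemma cnj_Psi_polar:
  assumes "r \<le> 1"
  shows "cnj (Psi_polar m n r \<theta>) = cis (- (of_int m * \<theta>)) * of_real (bessel_J m (bessel_zero m n * r) / Psi_norm m n)"
proof -
  have "exp (\<i> * of_int m * of_real \<theta>) = cis (of_int m * \<theta>)" by (simp add: cis_conv_exp mult.assoc)
  thus ?thesis using assms by (simp add: Psi_polar_def Psi_norm_def cis_cnj)
qed

text \<open>The Jacobian joins the kernel, giving the shape required by
  \<open>bounded_functional_iterated\<close>.\<close>

lemma FB_coeff_weight:
  "FB_coeff m n f = integral {0..2 * pi} (\<lambda>\<theta>. integral {0..1} (\<lambda>r. f (r * cos \<theta>, r * sin \<theta>) *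
     (cis (- (of_int m * \<theta>)) * of_real (bessel_J m (bessel_zero m n * r) / Psi_norm m n * r))))"
  unfolding FB_coeff_def
  by (intro integral_cong) (simp add: cnj_Psi_polar mult.assoc)

lemma bounded_functional_FB_coeff: "bounded_functional (FB_coeff m n)"
  unfolding FB_coeff_weight[abs_def]
proof (rule bounded_functional_iterated)
  show "continuous_on ({0..2 * pi} \<times> {0..1}) (\<lambda>(\<theta>, r). (r * cos \<theta>, r * sin \<theta>))"
    by (auto simp: case_prod_unfold intro!: continuous_intros)
  show "continuous_on ({0..2 * pi} \<times> {0..1}) (\<lambda>(\<theta>, r). cis (- (of_int m * \<theta>)) *
      complex_of_real (bessel_J m (bessel_zero m n * r) / Psi_norm m n * r))"
    unfolding case_prod_unfold divide_inverse by (intro continuous_intros)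
  fix \<theta> r :: real assume "r \<in> {0..1}"
  hence r: "\<bar>r\<bar> \<le> 1" by simp
  have "\<bar>r * cos \<theta>\<bar> \<le> 1 * 1" "\<bar>r * sin \<theta>\<bar> \<le> 1 * 1"
    unfolding abs_mult by (intro mult_mono r abs_cos_le_one abs_sin_le_one; simp)+
  thus "(r * cos \<theta>, r * sin \<theta>) \<in> unit_square" by (auto simp: unit_square_def abs_le_iff)
qed auto

lemma mode_polar:
  "mode k (r * cos \<theta>, r * sin \<theta>) = cis (pi * norm (real_vec k) * r * cos (\<theta> - polar_angle (real_vec k)))"
proof -
  define z where "z = Complex (of_int (fst k)) (of_int (snd k))"
  define \<phi> where "\<phi> = Arg z"
  have pa: "polar_angle (real_vec k) = \<phi>" and nm: "norm (real_vec k) = cmod z"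
    by (simp_all add: polar_angle_def real_vec_def z_def \<phi>_def norm_Pair cmod_def)
  have "z = rcis (cmod z) \<phi>" by (simp add: \<phi>_def rcis_cmod_Arg)
  hence "Re z = cmod z * cos \<phi>" "Im z = cmod z * sin \<phi>"
    by (metis Re_rcis, metis Im_rcis)
  hence k: "of_int (fst k) = cmod z * cos \<phi>" "of_int (snd k) = cmod z * sin \<phi>"
    by (simp_all add: z_def)
  show ?thesis
    unfolding mode_def pa nm fst_conv snd_conv k cos_diff by (simp add: algebra_simps)
qed

text \<open>After swapping the integrals, the angular one is evaluated for each radius and Lommel's
  integral does the rest, including the limiting value of the quotient. The 4 cancels the 1/4 of the
  Fourier inversion.\<close>

lemma FB_coeff_mode:
  assumes n: "n \<ge> 1"
  shows "FB_coeff m n (mode k) = 4 * c_coeff k m n"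
proof -
  define z where "z = bessel_zero m n"
  define t where "t = pi * norm (real_vec k)"
  define \<phi> where "\<phi> = polar_angle (real_vec k)"
  define N where "N = Psi_norm m n"
  define J1 where "J1 = bessel_J (m + 1) z"
  define A where "A = of_real (2 * pi) * \<i> powi m * cis (- (of_int m * \<phi>))"
  note zero = bessel_zero_eps[OF n, where m = m, folded z_def]
  have "FB_coeff m n (mode k) = integral {0..2 * pi} (\<lambda>\<theta>. integral {0..1} (\<lambda>r.
      cis (t * r * cos (\<theta> - \<phi>)) * (cis (- (of_int m * \<theta>)) * of_real (bessel_J m (z * r) / N * r))))"
    by (simp only: FB_coeff_weight mode_polar t_def \<phi>_def z_def N_def)
  also have "\<dots> = integral {0..1} (\<lambda>r. integral {0..2 * pi} (\<lambda>\<theta>.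
      cis (t * r * cos (\<theta> - \<phi>)) * (cis (- (of_int m * \<theta>)) * of_real (bessel_J m (z * r) / N * r))))"
  proof -
    have "continuous_on (cbox (0, 0) (2 * pi, 1)) (\<lambda>(\<theta>, r).
       cis (t * r * cos (\<theta> - \<phi>)) * (cis (- (of_int m * \<theta>)) * of_real (bessel_J m (z * r) / N * r)))"
      unfolding case_prod_unfold divide_inverse by (intro continuous_intros)
    from integral_swap_continuous[OF this] show ?thesis by simp
  qed
  also have "\<dots> = integral {0..1} (\<lambda>r. A * of_real (r * bessel_J m (z * r) * bessel_J m (t * r)) / of_real N)"
  proof (intro integral_cong)
    fix r :: real
    have "((\<lambda>\<theta>. cis (t * r * cos (\<theta> - \<phi>)) * cis (- (of_int m * \<theta>)) * of_real (bessel_J m (z * r) / N * r)) has_integral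
        A * of_real (bessel_J m (t * r)) * of_real (bessel_J m (z * r) / N * r)) {0..2 * pi}"
      unfolding A_def by (intro has_integral_mult_left angular_integral_bessel)
    hence "integral {0..2 * pi} (\<lambda>\<theta>. cis (t * r * cos (\<theta> - \<phi>)) * cis (- (of_int m * \<theta>)) * of_real (bessel_J m (z * r) / N * r)) =
        A * of_real (bessel_J m (t * r)) * of_real (bessel_J m (z * r) / N * r)"
      by (rule integral_unique)
    thus "integral {0..2 * pi} (\<lambda>\<theta>. cis (t * r * cos (\<theta> - \<phi>)) * (cis (- (of_int m * \<theta>)) * of_real (bessel_J m (z * r) / N * r))) =
        A * of_real (r * bessel_J m (z * r) * bessel_J m (t * r)) / of_real N"
      by (simp add: mult_ac)
  qed
  also have "\<dots> = A * of_real (- (z * J1 * bessel_quotient m n t)) / of_real N"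
  proof (intro integral_unique has_integral_divide has_integral_mult_right has_integral_of_real)
    show "((\<lambda>r. r * bessel_J m (z * r) * bessel_J m (t * r)) has_integral - (z * J1 * bessel_quotient m n t)) {0..1}"
      unfolding J1_def by (rule zero(5)) (simp add: t_def)
  qed
  also have "\<dots> = A * of_real (- J1 / N) * of_real (z * bessel_quotient m n t)"
    by simp
  \<comment> \<open>The sign of J_(m+1) at the n-th zero is known, so its absolute value cancels and
    leaves \<open>eps m * (-1) ^ n\<close>.\<close>
  also have "- J1 / N = eps m * (-1) ^ n / sqrt pi"
    using zero(3,4) unfolding N_def Psi_norm_def J1_def z_def[symmetric]
    by (metis (no_types, opaque_lifting) abs_eq_0 minus_equation_iff mult.commute nonzero_mult_divide_mult_cancel_left)
  also have "A * of_real (eps m * (-1) ^ n / sqrt pi) * of_real (z * bessel_quotient m n t) = 4 * c_coeff k m n"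
  proof -
    have "2 * pi * (eps m * (-1) ^ n / sqrt pi) = 2 * (eps m * sqrt pi * (-1) ^ n)"
      using real_div_sqrt[of pi] by (simp add: field_simps)
    hence 1: "complex_of_real (2 * pi) * of_real (eps m * (-1) ^ n / sqrt pi) = 2 * of_real (eps m * sqrt pi * (-1) ^ n)"
      by (metis of_real_mult of_real_numeral)
    have 2: "exp (- \<i> * of_int m * of_real \<phi>) = cis (- (of_int m * \<phi>))"
      by (simp add: cis_conv_exp mult.assoc)
    have "A * of_real (eps m * (-1) ^ n / sqrt pi) * of_real (z * bessel_quotient m n t) =
        (complex_of_real (2 * pi) * of_real (eps m * (-1) ^ n / sqrt pi)) *
          (\<i> powi m * cis (- (of_int m * \<phi>)) * of_real (z * bessel_quotient m n t))"
      by (simp only: A_def mult_ac)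
    also have "\<dots> = 4 * c_coeff k m n"
      unfolding 1 c_coeff_def t_def[symmetric] \<phi>_def[symmetric] z_def[symmetric] 2
      by (simp add: mult_ac)
    finally show ?thesis .
  qed
  finally show ?thesis .
qed

section \<open>Decay of the coefficients\<close>

text \<open>A product majorant of |k|^(-5/2) up to a constant: half the exponent goes to each
  coordinate, and since 5/4 > 1 summability reduces to two one-dimensional series.\<close>

definition lattice_weight :: "int \<times> int \<Rightarrow> real" where
  "lattice_weight k = (1 + \<bar>of_int (fst k)\<bar>) powr (- (5 / 4)) * (1 + \<bar>of_int (snd k)\<bar>) powr (- (5 / 4))"

lemma lattice_weight_pos: "lattice_weight k > 0"
proof -
  have "1 + \<bar>of_int j\<bar> \<noteq> (0 :: real)" for j :: int
    using abs_ge_zero[of "of_int j :: real"] by linarith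
  thus ?thesis by (simp add: lattice_weight_def)
qed

lemma summable_on_lattice_weight: "lattice_weight summable_on UNIV"
proof -
  define a where "a = (\<lambda>j::int. (1 + \<bar>real_of_int j\<bar>) powr (- (5 / 4)))"
  have s: "summable (\<lambda>n. real (n + k) powr (- (5 / 4)))" for k
    using summable_ignore_initial_segment[of "\<lambda>n. real n powr (- (5 / 4))" k] summable_real_powr_iff[of "- (5 / 4)"]
    by simp
  have "a summable_on range int"
    using s[of 1] by (subst summable_on_reindex) (auto simp: a_def o_def summable_on_UNIV_nonneg_real_iff add.commute)
  moreover have "a summable_on range (\<lambda>n. - int (Suc n))"
    using s[of 2] by (subst summable_on_reindex) (auto simp: a_def o_def summable_on_UNIV_nonneg_real_iff add.commute inj_on_def)
  moreover have "range int \<inter> range (\<lambda>n. - int (Suc n)) = {}" by auto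
  ultimately have "a summable_on (range int \<union> range (\<lambda>n. - int (Suc n)))"
    by (rule summable_on_Un_disjoint)
  also have "range int \<union> range (\<lambda>n. - int (Suc n)) = UNIV"
  proof -
    have "j \<in> range int \<union> range (\<lambda>n. - int (Suc n))" for j :: int
      by (cases j rule: int_cases) auto
    thus ?thesis by blast
  qed
  finally have a: "a summable_on UNIV" .
  have "(\<lambda>k. a (fst k) * a (snd k)) summable_on Sigma UNIV (\<lambda>_. UNIV)"
  proof (rule summable_on_SigmaI)
    show "((\<lambda>y. a (fst (x, y)) * a (snd (x, y))) has_sum a x * infsum a UNIV) UNIV" for x
      using has_sum_cmult_right[OF has_sum_infsum[OF a]] by simp
    show "(\<lambda>x. a x * infsum a UNIV) summable_on UNIV"
      using a by (rule summable_on_cmult_left)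
  qed (auto simp: a_def)
  thus ?thesis by (simp add: a_def lattice_weight_def[abs_def])
qed

text \<open>Outside the box one coordinate exceeds \<open>K\<close>; its factor is at most K^(-5/4)
  <= 1/K and the other factor is at most 1.\<close>

lemma lattice_weight_le_inverse:
  assumes "K \<ge> 1" "\<not> max \<bar>fst k\<bar> \<bar>snd k\<bar> \<le> int K"
  shows "lattice_weight k \<le> 1 / real K"
proof -
  have le1: "(1 + \<bar>real_of_int j\<bar>) powr (- (5 / 4)) \<le> 1" for j
    using powr_mono2'[of "- (5 / 4)" 1 "1 + \<bar>real_of_int j\<bar>"] by simp
  have leK: "(1 + \<bar>real_of_int j\<bar>) powr (- (5 / 4)) \<le> 1 / real K" if "\<bar>j\<bar> > int K" for j
  proof -
    have "real K \<le> 1 + \<bar>real_of_int j\<bar>" using that by linarith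
    hence "(1 + \<bar>real_of_int j\<bar>) powr (- (5 / 4)) \<le> real K powr (- (5 / 4))"
      using assms(1) by (intro powr_mono2') auto
    also have "\<dots> \<le> real K powr (- 1)"
      using assms(1) by (intro powr_mono) auto
    finally show ?thesis using assms(1) by (simp add: powr_minus_divide)
  qed
  consider "\<bar>fst k\<bar> > int K" | "\<bar>snd k\<bar> > int K" using assms(2) by linarith
  thus ?thesis
  proof cases
    case 1
    hence "lattice_weight k \<le> (1 / real K) * 1"
      unfolding lattice_weight_def by (intro mult_mono leK le1) auto
    thus ?thesis by simp
  next
    case 2
    hence "lattice_weight k \<le> 1 * (1 / real K)"
      unfolding lattice_weight_def by (intro mult_mono leK le1) auto
    thus ?thesis by simp
  qed
qed

text \<open>For nonzero \<open>k\<close> the maximum M of the |k_i| is at least 1, so each 1 + |k_i|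
  is at most 2 M and their product at most 4 |k|^2; raising to the power -5/4 reverses this.\<close>

lemma norm_powr_le_lattice_weight:
  assumes "k \<noteq> 0"
  shows "norm (real_vec k) powr (- (5 / 2)) \<le> 4 powr (5 / 4) * lattice_weight k"
proof -
  define M :: real where "M = of_int (max \<bar>fst k\<bar> \<bar>snd k\<bar>)"
  define x y :: real where "x = 1 + \<bar>of_int (fst k)\<bar>" and "y = 1 + \<bar>of_int (snd k)\<bar>"
  have xy: "x > 0" "y > 0" unfolding x_def y_def by linarith+
  have "max \<bar>fst k\<bar> \<bar>snd k\<bar> \<ge> 1" using assms by (auto simp: prod_eq_iff max_def)
  hence M1: "M \<ge> 1" unfolding M_def by linarith
  have M: "M \<le> norm (real_vec k)"
    using norm_fst_le[of "of_int (fst k) :: real" "of_int (snd k) :: real"] norm_snd_le[of "of_int (snd k) :: real" "of_int (fst k) :: real"]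
    by (auto simp: real_vec_def M_def max_def)
  have "x * y \<le> (2 * M) * (2 * M)"
    using M1 by (intro mult_mono) (auto simp: x_def y_def M_def)
  also have "\<dots> \<le> 4 * (norm (real_vec k))\<^sup>2"
    using M M1 by (simp add: power2_eq_square mult_mono)
  finally have "x * y / 4 \<le> (norm (real_vec k))\<^sup>2" by simp
  hence "((norm (real_vec k))\<^sup>2) powr (- (5 / 4)) \<le> (x * y / 4) powr (- (5 / 4))"
    using xy by (intro powr_mono2') auto
  also have "(norm (real_vec k))\<^sup>2 = norm (real_vec k) powr 2"
    using M M1 by simp
  also have "(norm (real_vec k) powr 2) powr (- (5 / 4)) = norm (real_vec k) powr (- (5 / 2))"
    by (simp only: powr_powr) simp
  also have "(x * y / 4) powr (- (5 / 4)) = 4 powr (5 / 4) * (x powr (- (5 / 4)) * y powr (- (5 / 4)))"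
    using xy by (simp add: powr_divide powr_mult powr_minus divide_simps)
  finally show ?thesis by (simp add: lattice_weight_def x_def y_def)
qed

lemma bessel_J_decay:
  obtains C where "C \<ge> 0" "\<And>t. t > 0 \<Longrightarrow> \<bar>bessel_J m t\<bar> * sqrt t \<le> C"
proof -
  obtain n where n: "m = int n \<or> m = - int n" by (metis nonneg_int_cases nonpos_int_cases linear)
  obtain C where C: "\<And>t. t > 0 \<Longrightarrow> \<bar>bessel_J (int n) t\<bar> * sqrt t \<le> C"
    using bessel_J_decay_nat[of n] by blast
  have "\<bar>bessel_J m t\<bar> = \<bar>bessel_J (int n) t\<bar>" for t
    using n by (auto simp: bessel_J_uminus abs_mult)
  moreover have "0 \<le> C" using C[of 1] by simp
  ultimately show thesis using C by (intro that[of C]) auto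
qed

lemma norm_c_coeff:
  assumes "n \<ge> 1"
  shows "cmod (c_coeff k m n) = sqrt pi * bessel_zero m n * \<bar>bessel_quotient m n (pi * norm (real_vec k))\<bar> / 2"
proof -
  have "cmod (exp (- \<i> * of_int m * of_real x)) = 1" for x :: real
    by (simp add: norm_exp_eq_Re)
  moreover have "\<bar>eps m\<bar> = 1" by (auto simp: eps_def power_int_def power_abs)
  moreover have "cmod (\<i> powi m) = 1" by (simp add: norm_power_int)
  ultimately show ?thesis
    using bessel_zero_eps(1)[OF assms, of m] by (simp add: c_coeff_def norm_mult norm_divide abs_mult norm_power)
qed

text \<open>For |k| >= 2 z the denominator t^2 - z^2 is at least t^2 / 2, and J_m = O(t^(-1/2))
  yields t^(-5/2). The finitely many remaining \<open>k\<close>, among them any with pi |k| = z, are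
  absorbed into the constant.\<close>

lemma c_coeff_bound:
  assumes n: "n \<ge> 1"
  obtains D where "D \<ge> 0" "\<And>k. cmod (c_coeff k m n) \<le> D * lattice_weight k"
proof -
  define z where "z = bessel_zero m n"
  have z: "z > 0" using bessel_zero_eps(1)[OF n] by (simp add: z_def)
  obtain C where C: "C \<ge> 0" "\<And>t. t > 0 \<Longrightarrow> \<bar>bessel_J m t\<bar> * sqrt t \<le> C"
    using bessel_J_decay[of m] by blast
  define E where "E = sqrt pi * z * C * 4 powr (5 / 4)"
  have E: "E \<ge> 0" using z C by (simp add: E_def)
  have far: "cmod (c_coeff k m n) \<le> E * lattice_weight k" if k: "norm (real_vec k) \<ge> 2 * z" for k
  proof -
    define r where "r = norm (real_vec k)"
    define t where "t = pi * r"
    have r: "r > 0" "r \<ge> 2 * z" using k z by (auto simp: r_def)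
    have rt: "r \<le> t" using pi_gt3 r by (simp add: t_def)
    hence t: "t > 0" "t \<ge> 2 * z" using r by auto
    have "z\<^sup>2 \<le> (t / 2)\<^sup>2" using z t by (intro power_mono) auto
    hence "z\<^sup>2 \<le> t\<^sup>2 / 4" by (simp add: power_divide)
    hence den: "t\<^sup>2 / 2 \<le> t\<^sup>2 - z\<^sup>2" using zero_le_power2[of t] by linarith
    have "\<bar>bessel_quotient m n t\<bar> = \<bar>bessel_J m t\<bar> / (t\<^sup>2 - z\<^sup>2)"
      using t z den zero_le_power2[of t] by (simp add: bessel_quotient_def flip: z_def)
    also have "\<dots> \<le> (C / sqrt t) / (t\<^sup>2 / 2)"
      using C(1) C(2)[OF t(1)] t(1) den by (intro frac_le) (auto simp: field_simps)
    also have "\<dots> = 2 * C * t powr (- (5 / 2))"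
    proof -
      have "sqrt t * t\<^sup>2 = t powr (1 / 2) * t powr 2"
        using t(1) by (simp add: powr_half_sqrt)
      also have "\<dots> = t powr (5 / 2)" by (simp flip: powr_add)
      finally show ?thesis using t(1) by (simp add: powr_minus divide_simps)
    qed
    also have "\<dots> \<le> 2 * C * r powr (- (5 / 2))"
      using C(1) r rt by (intro mult_left_mono powr_mono2') auto
    also have "\<dots> \<le> 2 * C * (4 powr (5 / 4) * lattice_weight k)"
    proof -
      have "k \<noteq> 0" using r by (auto simp: r_def real_vec_def zero_prod_def)
      thus ?thesis using C(1) norm_powr_le_lattice_weight[of k] by (intro mult_left_mono) (auto simp: r_def)
    qed
    finally have "sqrt pi * z * \<bar>bessel_quotient m n t\<bar> / 2 \<le> sqrt pi * z * (2 * C * (4 powr (5 / 4) * lattice_weight k)) / 2"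
      using z by (intro divide_right_mono mult_left_mono) auto
    thus ?thesis
      by (simp add: norm_c_coeff[OF n] E_def mult_ac flip: z_def t_def r_def)
  qed
  define F where "F = {k. \<not> norm (real_vec k) \<ge> 2 * z}"
  have "finite F"
  proof (rule finite_subset)
    have bound: "\<bar>j\<bar> \<le> \<lceil>2 * z\<rceil>" if "\<bar>real_of_int j\<bar> < 2 * z" for j using that by linarith
    have "\<bar>fst k\<bar> \<le> \<lceil>2 * z\<rceil> \<and> \<bar>snd k\<bar> \<le> \<lceil>2 * z\<rceil>" if "k \<in> F" for k
      using that norm_fst_le[of "of_int (fst k) :: real" "of_int (snd k) :: real"] norm_snd_le[of "of_int (snd k) :: real" "of_int (fst k) :: real"]
      by (intro conjI bound) (auto simp: F_def real_vec_def)
    thus "F \<subseteq> {- \<lceil>2 * z\<rceil>..\<lceil>2 * z\<rceil>} \<times> {- \<lceil>2 * z\<rceil>..\<lceil>2 * z\<rceil>}"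
      by (force simp: abs_le_iff)
  qed auto
  define D where "D = E + (\<Sum>k\<in>F. cmod (c_coeff k m n) / lattice_weight k)"
  have S: "0 \<le> (\<Sum>k\<in>F. cmod (c_coeff k m n) / lattice_weight k)"
    using lattice_weight_pos by (intro sum_nonneg divide_nonneg_pos) auto
  show thesis
  proof
    show "D \<ge> 0" using E S by (simp add: D_def)
    fix k show "cmod (c_coeff k m n) \<le> D * lattice_weight k"
    proof (cases "k \<in> F")
      case True
      have "cmod (c_coeff k m n) / lattice_weight k \<le> (\<Sum>k\<in>F. cmod (c_coeff k m n) / lattice_weight k)"
        using lattice_weight_pos less_imp_le by (intro member_le_sum[OF True _ \<open>finite F\<close>] divide_nonneg_pos) auto
      also have "\<dots> \<le> D" using E by (simp add: D_def)
      finally show ?thesis using lattice_weight_pos[of k] by (simp add: divide_simps)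
    next
      case False
      hence "cmod (c_coeff k m n) \<le> E * lattice_weight k" using far by (simp add: F_def)
      also have "\<dots> \<le> D * lattice_weight k"
        using S lattice_weight_pos[of k] by (intro mult_right_mono) (auto simp: D_def)
      finally show ?thesis .
    qed
  qed
qed

section \<open>Assembly of the error bound\<close>

lemma Psi_bounded:
  obtains P where "P \<ge> 0" "\<And>x. cmod (Psi m n x) \<le> P"
proof -
  have "compact ((\<lambda>r. bessel_J m (bessel_zero m n * r)) ` {0..1})"
    by (intro compact_continuous_image continuous_intros) auto
  then obtain B where B: "\<forall>y\<in>(\<lambda>r. bessel_J m (bessel_zero m n * r)) ` {0..1}. norm y \<le> B"
    using compact_imp_bounded bounded_iff by metis
  define N where "N = Psi_norm m n"
  have N: "N \<ge> 0" by (simp add: N_def Psi_norm_def)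
  have e: "cmod (exp (\<i> * of_int m * of_real x)) = 1" for x :: real
    by (simp add: norm_exp_eq_Re)
  have "cmod (Psi m n x) \<le> max 0 (B / N)" for x
  proof (cases "norm x \<le> 1")
    case True
    hence "cmod (Psi m n x) = \<bar>bessel_J m (bessel_zero m n * norm x)\<bar> / N"
      using N by (simp add: Psi_def Psi_polar_def norm_mult norm_divide e N_def Psi_norm_def abs_mult)
    also have "\<dots> \<le> B / N" using B True N by (intro divide_right_mono) auto
    finally show ?thesis by simp
  qed (simp add: Psi_def Psi_polar_def)
  thus thesis by (intro that[of "max 0 (B / N)"]) auto
qed

text \<open>\<open>E\<close> is fixed before \<open>m\<close> and \<open>n\<close>: it combines the
  total lattice weight \<open>S\<close>, the quadrature constant \<open>C\<close> of
  \<open>f\<close> and the sum \<open>A\<close> of its Fourier coefficients. The order and index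
  enter only through \<open>D\<close>.\<close>

lemma finite_FB_coeff_error:
  assumes f: "f \<in> C_space 1 \<inter> A_space" and supp: "support_on UNIV f \<subseteq> ball 0 1"
  obtains E where "E > 0"
    "\<And>m n D K. n \<ge> 1 \<Longrightarrow> D \<ge> 0 \<Longrightarrow> (\<And>k. cmod (c_coeff k m n) \<le> D * lattice_weight k) \<Longrightarrow> K \<ge> 1 \<Longrightarrow>
       cmod (finite_FB_coeff K m n f - FB_coeff m n f) \<le> E * D / real K"
proof -
  have cont: "continuous_on UNIV f" using f by simp
  have fc: "fourier_coeff f k = square_coeff f k" for k
    by (rule fourier_coeff_eq_square_coeff[OF cont supp])
  have abs: "(\<lambda>k. cmod (square_coeff f k)) summable_on UNIV"
    using f by (simp add: A_space_def fc)
  obtain C where C: "C > 0" "\<And>L k. L \<ge> 1 \<Longrightarrow> 2 * \<bar>fst k\<bar> \<le> int L \<Longrightarrow> 2 * \<bar>snd k\<bar> \<le> int L \<Longrightarrow>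
       cmod (finite_fourier L f k - fourier_coeff f k) \<le> C / real L"
    using finite_fourier_error[OF _ supp] f by blast
  define A where "A = (\<Sum>\<^sub>\<infinity>k. cmod (square_coeff f k))"
  define S where "S = (\<Sum>\<^sub>\<infinity>k. lattice_weight k)"
  have A: "((\<lambda>k. cmod (square_coeff f k)) has_sum A) UNIV"
    unfolding A_def by (rule has_sum_infsum[OF abs])
  have A0: "A \<ge> 0" unfolding A_def by (rule infsum_nonneg) auto
  have S0: "S \<ge> 0" unfolding S_def using lattice_weight_pos by (intro infsum_nonneg) (auto intro: less_imp_le)
  show thesis
  proof
    show "S * C + A + 1 > 0" using A0 S0 C(1) by (simp add: add_nonneg_pos)
    fix m :: int and n K :: nat and D :: real
    assume n: "n \<ge> 1" and D: "D \<ge> 0" "\<And>k. cmod (c_coeff k m n) \<le> D * lattice_weight k" and K: "K \<ge> 1"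
    define B where "B = {k :: int \<times> int. max \<bar>fst k\<bar> \<bar>snd k\<bar> \<le> int K}"
    have B_finite: "finite B"
      by (rule finite_subset[of _ "{- int K..int K} \<times> {- int K..int K}"]) (auto simp: B_def abs_le_iff)
    define h where "h = (\<lambda>k. square_coeff f k * c_coeff k m n)"
    have "((\<lambda>k. square_coeff f k / 4 * FB_coeff m n (mode k)) has_sum FB_coeff m n f) UNIV"
    proof (rule bounded_functional_has_sum[OF bounded_functional_FB_coeff continuous_on_mode _ _ cont])
      show "(\<lambda>k. cmod (square_coeff f k / 4)) summable_on UNIV"
        using summable_on_cmult_right[OF abs, of "1 / 4"] by (simp add: norm_divide)
      show "((\<lambda>k. square_coeff f k / 4 * mode k x) has_sum f x) UNIV" if "x \<in> unit_square" for x
        by (rule fourier_inversion[OF cont abs that])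
    qed simp
    hence sum: "(h has_sum FB_coeff m n f) UNIV"
      by (simp add: FB_coeff_mode[OF n] h_def)
    \<comment> \<open>Outside the box each coefficient is at most D / K, and the Fourier
      coefficients of \<open>f\<close> are summable because \<open>f\<close> lies in
      \<open>A_space\<close>.\<close>
    have tail: "cmod (FB_coeff m n f - sum h B) \<le> D / real K * A"
    proof (rule norm_infsum_le)
      have "(h has_sum FB_coeff m n f - sum h B) (UNIV - B)"
        by (intro has_sum_Diff sum has_sum_finite B_finite) auto
      also have "?this \<longleftrightarrow> ((\<lambda>k. if k \<in> B then 0 else h k) has_sum FB_coeff m n f - sum h B) UNIV"
        by (rule has_sum_cong_neutral) auto
      finally show "((\<lambda>k. if k \<in> B then 0 else h k) has_sum FB_coeff m n f - sum h B) UNIV" .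
      show "((\<lambda>k. D / real K * cmod (square_coeff f k)) has_sum D / real K * A) UNIV"
        by (rule has_sum_cmult_right[OF A])
      fix k
      show "cmod (if k \<in> B then 0 else h k) \<le> D / real K * cmod (square_coeff f k)"
      proof (cases "k \<in> B")
        case False
        have "cmod (c_coeff k m n) \<le> D * lattice_weight k" by (rule D)
        also have "\<dots> \<le> D * (1 / real K)"
          using False D(1) by (intro mult_left_mono lattice_weight_le_inverse K) (auto simp: B_def)
        finally have "cmod (c_coeff k m n) * cmod (square_coeff f k) \<le> D * (1 / real K) * cmod (square_coeff f k)"
          by (intro mult_right_mono) auto
        thus ?thesis using False by (simp add: h_def norm_mult mult.commute)
      qed (use D in simp)
    qed
    \<comment> \<open>Inside the box the roles are exchanged: the quadrature error is uniformly at
      most C / K, since 2 |k_i| <= 2 K + 1, and the weights are summed.\<close>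
    have "cmod (\<Sum>k\<in>B. c_coeff k m n * finite_fourier (2 * K + 1) f k - h k) \<le> (\<Sum>k\<in>B. D * lattice_weight k * (C / real K))"
    proof (rule sum_norm_le)
      fix k assume k: "k \<in> B"
      have "cmod (finite_fourier (2 * K + 1) f k - fourier_coeff f k) \<le> C / real (2 * K + 1)"
        using k by (intro C(2)) (auto simp: B_def)
      also have "\<dots> \<le> C / real K"
        using C(1) K by (intro divide_left_mono) auto
      finally have "cmod (c_coeff k m n) * cmod (finite_fourier (2 * K + 1) f k - fourier_coeff f k) \<le> D * lattice_weight k * (C / real K)"
        using D lattice_weight_pos[of k] by (intro mult_mono) (auto intro: less_imp_le)
      thus "cmod (c_coeff k m n * finite_fourier (2 * K + 1) f k - h k) \<le> D * lattice_weight k * (C / real K)"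
        by (simp add: h_def fc right_diff_distrib mult.commute flip: norm_mult)
    qed
    also have "\<dots> = D * C / real K * sum lattice_weight B"
      unfolding sum_distrib_left by (intro sum.cong) (simp_all add: mult_ac)
    also have "\<dots> \<le> D * C / real K * S"
      unfolding S_def using D(1) C(1) lattice_weight_pos
      by (intro mult_left_mono finite_sum_le_infsum[OF summable_on_lattice_weight B_finite]) (auto intro: less_imp_le)
    finally have head: "cmod (finite_FB_coeff K m n f - sum h B) \<le> D * C / real K * S"
      by (simp add: finite_FB_coeff_def B_def sum_subtractf)
    have "cmod (finite_FB_coeff K m n f - FB_coeff m n f) \<le> cmod (finite_FB_coeff K m n f - sum h B) + cmod (FB_coeff m n f - sum h B)"
      using norm_triangle_ineq4[of "finite_FB_coeff K m n f - sum h B" "FB_coeff m n f - sum h B"] by simp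
    also have "\<dots> \<le> D * C / real K * S + D / real K * A"
      by (intro add_mono head tail)
    also have "\<dots> = (S * C + A) * D / real K"
      using K by (simp add: field_simps)
    also have "\<dots> \<le> (S * C + A + 1) * D / real K"
      using D(1) by (intro divide_right_mono mult_right_mono) auto
    finally show "cmod (finite_FB_coeff K m n f - FB_coeff m n f) \<le> (S * C + A + 1) * D / real K" .
  qed
qed

theorem theorem3p9:
  "\<exists>(c :: plane_fun \<Rightarrow> real) (D :: nat \<Rightarrow> nat \<Rightarrow> real).
     (\<forall>f \<in> C_space 1 \<inter> A_space. support_on UNIV f \<subseteq> ball 0 1 \<longrightarrow> c f > 0) \<and>
     (\<forall>M\<ge>1. \<forall>N\<ge>1. D M N > 0) \<and>
     (\<forall>f \<in> C_space 1 \<inter> A_space. support_on UNIV f \<subseteq> ball 0 1 \<longrightarrow>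
        (\<forall>M\<ge>1. \<forall>N\<ge>1. \<forall>K\<ge>1. int K \<ge> K_max M N \<longrightarrow>
           sup_norm (\<lambda>x. finite_FB_sum K M N f x - FB_sum M N f x)
             \<le> ereal (2 * c f * D M N / real K)))"
proof -
  \<comment> \<open>\<open>d\<close> and \<open>P\<close> are chosen before any \<open>f\<close>,
    and \<open>c\<close> afterwards for each \<open>f\<close> but all \<open>m\<close>,
    \<open>n\<close>, \<open>K\<close> at once; this gives the required dependence of the
    constants.\<close>
  have "\<forall>m n. \<exists>D. n \<ge> 1 \<longrightarrow> D \<ge> 0 \<and> (\<forall>k. cmod (c_coeff k m n) \<le> D * lattice_weight k)"
    by (metis c_coeff_bound)
  then obtain d where d: "\<And>m n. n \<ge> 1 \<Longrightarrow> d m n \<ge> 0"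
      "\<And>m n k. n \<ge> 1 \<Longrightarrow> cmod (c_coeff k m n) \<le> d m n * lattice_weight k"
    by metis
  have "\<forall>m n. \<exists>P. P \<ge> 0 \<and> (\<forall>x. cmod (Psi m n x) \<le> P)"
    by (metis Psi_bounded)
  then obtain P where P: "\<And>m n. P m n \<ge> 0" "\<And>m n x. cmod (Psi m n x) \<le> P m n"
    by metis
  have "\<forall>f. \<exists>E. f \<in> C_space 1 \<inter> A_space \<and> support_on UNIV f \<subseteq> ball 0 1 \<longrightarrow> E > 0 \<and>
      (\<forall>m n K. n \<ge> 1 \<longrightarrow> K \<ge> 1 \<longrightarrow> cmod (finite_FB_coeff K m n f - FB_coeff m n f) \<le> E * d m n / real K)"
    by (metis finite_FB_coeff_error d)
  then obtain c where c: "\<And>f. f \<in> C_space 1 \<inter> A_space \<Longrightarrow> support_on UNIV f \<subseteq> ball 0 1 \<Longrightarrow> c f > 0"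
      "\<And>f m n K. f \<in> C_space 1 \<inter> A_space \<Longrightarrow> support_on UNIV f \<subseteq> ball 0 1 \<Longrightarrow> n \<ge> 1 \<Longrightarrow> K \<ge> 1 \<Longrightarrow>
         cmod (finite_FB_coeff K m n f - FB_coeff m n f) \<le> c f * d m n / real K"
    by metis
  \<comment> \<open>The summand 1 makes \<open>D M N\<close> positive even if all
    \<open>d m n * P m n\<close> vanish.\<close>
  define D where "D = (\<lambda>M N. 1 + (\<Sum>m\<in>{- int M..int M}. \<Sum>n\<in>{1..N}. d m n * P m n))"
  have D: "D M N > 0" for M N
    unfolding D_def using d(1) P(1) by (intro add_pos_nonneg sum_nonneg mult_nonneg_nonneg) auto
  have "sup_norm (\<lambda>x. finite_FB_sum K M N f x - FB_sum M N f x) \<le> ereal (2 * c f * D M N / real K)"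
    if f: "f \<in> C_space 1 \<inter> A_space" "support_on UNIV f \<subseteq> ball 0 1" and K: "K \<ge> 1" for f K M N
    unfolding sup_norm_def
  proof (rule SUP_least, unfold ereal_less_eq)
    fix x
    have "finite_FB_sum K M N f x - FB_sum M N f x =
        (\<Sum>m\<in>{- int M..int M}. \<Sum>n\<in>{1..N}. (finite_FB_coeff K m n f - FB_coeff m n f) * Psi m n x)"
      by (simp add: finite_FB_sum_def FB_sum_def left_diff_distrib flip: sum_subtractf)
    also have "cmod \<dots> \<le> (\<Sum>m\<in>{- int M..int M}. \<Sum>n\<in>{1..N}. (c f * d m n / real K) * P m n)"
    proof (intro sum_norm_le)
      fix m :: int and n :: nat assume "n \<in> {1..N}"
      hence n: "n \<ge> 1" by simp
      show "cmod ((finite_FB_coeff K m n f - FB_coeff m n f) * Psi m n x) \<le> (c f * d m n / real K) * P m n"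
        unfolding norm_mult using c(1)[OF f] d(1)[OF n] by (intro mult_mono c(2) f n K P) auto
    qed
    also have "\<dots> = c f / real K * (\<Sum>m\<in>{- int M..int M}. \<Sum>n\<in>{1..N}. d m n * P m n)"
      unfolding sum_distrib_left by (intro sum.cong) (simp_all add: mult_ac)
    also have "\<dots> \<le> c f / real K * (2 * D M N)"
      using c(1)[OF f] D[of M N] by (intro mult_left_mono) (auto simp: D_def)
    also have "\<dots> = 2 * c f * D M N / real K" by simp
    finally show "cmod (finite_FB_sum K M N f x - FB_sum M N f x) \<le> 2 * c f * D M N / real K" .
  qed
  with c(1) D show ?thesis by (intro exI[of _ c] exI[of _ D]) blast
qed

end
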